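(* Let $E$ be a finite directed graph with no sinks or sources. Let $(G,E)$ be a contracting, regular self-similar groupoid action and let $\mathcal{S}=E^{\mathbb{Z}}/{\sim_{ae}}$ be the limit solenoid of $(G,E)$. Then there is a homeomorphism $\tilde\tau:\mathcal{S}\to\mathcal{S}$ such that $\tilde\tau([x])=[\tau(x)]$ for all $x\in E^{\mathbb{Z}}$. Let $\mathcal{J}$ be the limit space of $(G,E)$, $\tilde\sigma:\mathcal{J}\to\mathcal{J}$ the map induced by the shift, and let $\varepsilon>0$, $c>1$ and $d_{\mathcal{J}}$ be such that $d_{\mathcal{J}}$ is a metric inducing the topology of $\mathcal{J}$, $d_{\mathcal{J}}(\tilde\sigma(a),\tilde\sigma(b))=c\,d_{\mathcal{J}}(a,b)$ whenever $d_{\mathcal{J}}(a,b)<\varepsilon$, and $\tilde\sigma(B(a,\alpha))=B(\tilde\sigma(a),c\alpha)$ whenever $a\in\mathcal{J}$ and $0<\alpha\le\varepsilon$. There is a metric $d_{\mathcal{S}}$ on $\mathcal{S}$ such that $$d_{\mathcal{S}}([x],[y])=\sup_{m\in\mathbb{N}_0}\Big(\frac1c\Big)^m d_{\mathcal{J}}\big([x(-\infty,m)],[y(-\infty,m)]\big)\quad\text{for all }x,y\in E^{\mathbb{Z}}.$$ There is a constant $\varepsilon_{\mathcal{S}}$ such that $(\mathcal{S},d_{\mathcal{S}},\tilde\tau,\varepsilon_{\mathcal{S}},\frac1c)$ is a Smale space with totally disconnected stable sets. If $E$ is strongly connected, then $(\mathcal{S},\tilde\tau)$ is irreducible. If $E$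 is primitive, then $(\mathcal{S},\tilde\tau)$ is topologically mixing.
   Context: **Graphs.** A directed graph is $E=(E^0,E^1,r,s)$ with $r,s:E^1\to E^0$. Paths are $\mu=e_1\cdots e_n$ with $s(e_i)=r(e_{i+1})$; $r(\mu)=r(e_1)$, $s(\mu)=s(e_n)$; $E^n$ is the set of paths of length $n$, $E^*=\bigcup_nE^n$; $vE^*$, $vE^n$ denote the paths with range $v$. No sources: $vE^1\ne\emptyset$ for all $v$; no sinks: $\{e:s(e)=v\}\neq\emptyset$ for all $v$. Strongly connected: for all $v,w\in E^0$ there is a path with range $v$ and source $w$, and $E$ is not the graph with one vertex and no edges. Primitive: there is $n\geq 1$ such that for all $v,w\in E^0$ there is a path of length $n$ with range $v$ and source $w$. $E^\infty$, $E^{-\infty}$, $E^{\mathbb{Z}}$ are the right-infinite ($e_1e_2\cdots$), left-infinite ($\cdots e_{-2}e_{-1}$) and bi-infinite paths (always $s(e_i)=r(e_{i+1})$), with cylinder-set topologies. **Self-similar groupoid actions.** A partial isomorphism of $E^*$ is a length-preserving bijection $g:vE^*\to wE^*$ with $g(\mu e)\in g(\mu)E^1$; $d(g)=v$, $c(g)=w$. These form a groupoid $\mathrm{PIso}(E^* )$ with unit space $E^0$. A self-similar groupoid action $(G,E)$ is a groupoid $G$ with unit space $E^0$ and an injective homomorphism $G\to\mathrm{PIso}(E^* )$, identity on $E^0$ (written $g\cdot\mu$), such that for all $g\in G$, $e\in d(g)E^1$ there is a (necessarily unique) $g|_e\in G$ with $d(g|_e)=s(e)$, $c(g|_e)=s(g\cdot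 e)$, $g\cdot(e\mu)=(g\cdot e)(g|_e\cdot\mu)$ for all $\mu\in s(e)E^*$. Put $g|_{d(g)}=g$, $g|_{e\mu}=(g|_e)|_\mu$. $G$ acts on right-infinite paths via initial segments. Contracting: there is a finite $F\subseteq G$ such that for every $g\in G$ there is $n\ge0$ with $\{g|_\mu:\mu\in d(g)E^n\}\subseteq F$. Regular: whenever $g\cdot y=y$ with $g\in G$, $y\in E^\infty$, $r(y)=d(g)$, some initial segment $\mu$ of $y$ has $g\cdot\mu=\mu$ and $g|_\mu=s(\mu)$. **Limit space and solenoid.** For $x,y\in E^{-\infty}$, $x\sim_{ae}y$ if there is $(g_n)_{n<0}$ in $G$ with finitely many values and $g_n\cdot(x_n\cdots x_{-1})=y_n\cdots y_{-1}$ for all $n<0$; $\mathcal{J}=E^{-\infty}/{\sim_{ae}}$ with the quotient topology; $\sigma(\cdots x_{-2}x_{-1})=\cdots x_{-3}x_{-2}$ and $\tilde\sigma([x])=[\sigma(x)]$. For $(G,E)$ contracting and regular, $\varepsilon,c,d_{\mathcal{J}}$ with the properties in the claim exist. For $x,y\in E^{\mathbb{Z}}$, $x\sim_{ae}y$ if there is $(g_n)_{n\in\mathbb{Z}}$ in $G$ with finitely many values and $g_n\cdot(x_nx_{n+1}\cdots)=y_ny_{n+1}\cdots$ for all $n\in\mathbb{Z}$; $\mathcal{S}=E^{\mathbb{Z}}/{\sim_{ae}}$ with the quotient topology. $\tau:E^{\mathbb{Z}}\to E^{\mathbb{Z}}$ is $\tau(x)_n=x_{n-1}$. For $x\in E^{\mathbb{Z}}$,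 $x(-\infty,n)=\cdots x_{n-2}x_{n-1}x_n$ regarded as an element of $E^{-\infty}$. **Smale spaces.** A Smale space $(X,d,\varphi,\varepsilon_X,\lambda)$ is a compact metric space $(X,d)$, a homeomorphism $\varphi$ of $X$, constants $\varepsilon_X>0$, $0<\lambda<1$, and a continuous map $[\cdot,\cdot]:\{(x,y):d(x,y)\le\varepsilon_X\}\to X$ such that: $[x,x]=x$; $[x,[y,z]]=[x,z]$, $[[x,y],z]=[x,z]$ and $\varphi[x,y]=[\varphi(x),\varphi(y)]$ whenever both sides are defined; $d(\varphi(x),\varphi(y))\le\lambda d(x,y)$ whenever $[x,y]=y$; and $d(\varphi^{-1}(x),\varphi^{-1}(y))\le\lambda d(x,y)$ whenever $[x,y]=x$. The stable class of $x$ is $X^s(x)=\{y:d(\varphi^n(x),\varphi^n(y))\to0\}$, with topology generated by the local stable sets $X^s(y,\epsilon)=\{z:d(y,z)<\epsilon,\ [z,y]=y\}$, $y\in X^s(x)$, $0<\epsilon<\varepsilon_X$; "totally disconnected stable sets" means these spaces are totally disconnected. Irreducible: for all non-empty open $U,V$ there is $N\in\mathbb{N}$ with $\varphi^N(U)\cap V\ne\emptyset$. Mixing: for all non-empty open $U,V$ there is $N$ with $\varphi^n(U)\cap V\neq\emptyset$ for all $n\ge N$. *)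

theory Defs
  imports "HOL-Analysis.Analysis" "Graph_Theory.Arc_Walk"
begin

section \<open>Graphs and paths\<close>

text \<open>
  A directed graph is a \<open>pre_digraph\<close> record \<open>E\<close>; the range map is \<open>head E\<close> and the source map
  is \<open>tail E\<close>.  Paths follow the convention of graph algebras: in \<open>e\<^sub>1 \<dots> e\<^sub>n\<close> one has
  \<open>s(e\<^sub>i) = r(e\<^bsub>i+1\<^esub>)\<close>, so the edges of a walk in the sense of \<open>awalk\<close> are listed in reverse.
  The vertex \<open>v\<close>, seen as a path of length zero, is the empty list among the paths with range \<open>v\<close>.
\<close>

definition is_path :: "('v, 'e) pre_digraph \<Rightarrow> 'v \<Rightarrow> 'e list \<Rightarrow> 'v \<Rightarrow> bool" where
  "is_path E v \<mu> w \<longleftrightarrow> pre_digraph.awalk E w (rev \<mu>) v"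

definition paths_to :: "('v, 'e) pre_digraph \<Rightarrow> 'v \<Rightarrow> 'e list set" where
  "paths_to E v = {\<mu>. \<exists>w. is_path E v \<mu> w}"

definition path_source :: "('v, 'e) pre_digraph \<Rightarrow> 'v \<Rightarrow> 'e list \<Rightarrow> 'v" where
  "path_source E v \<mu> = (if \<mu> = [] then v else tail E (last \<mu>))"

lemma is_path_Nil: "is_path E v [] w \<longleftrightarrow> v \<in> verts E \<and> w = v"
  unfolding is_path_def pre_digraph.awalk_def by (auto simp: pre_digraph.cas.simps)

lemma (in wf_digraph) is_path_Cons:
  "is_path G v (e # \<mu>) w \<longleftrightarrow> e \<in> arcs G \<and> head G e = v \<and> is_path G (tail G e) \<mu> w"
proof -
  have "cas u (p @ [e]) v \<longleftrightarrow> cas u p (tail G e) \<and> head G e = v" for u p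
    by (induction p arbitrary: u) auto
  moreover have "cas u p x \<Longrightarrow> x \<in> verts G \<Longrightarrow> set p \<subseteq> arcs G \<Longrightarrow> u \<in> verts G" for u p x
    by (cases p) auto
  ultimately show ?thesis
    unfolding is_path_def awalk_def by auto
qed

definition no_sources :: "('v, 'e) pre_digraph \<Rightarrow> bool" where
  "no_sources E \<longleftrightarrow> (\<forall>v\<in>verts E. in_arcs E v \<noteq> {})"

definition no_sinks :: "('v, 'e) pre_digraph \<Rightarrow> bool" where
  "no_sinks E \<longleftrightarrow> (\<forall>v\<in>verts E. out_arcs E v \<noteq> {})"

definition strongly_connected_graph :: "('v, 'e) pre_digraph \<Rightarrow> bool" where
  "strongly_connected_graph E \<longleftrightarrow>
     (\<forall>v\<in>verts E. \<forall>w\<in>verts E. \<exists>\<mu>. is_path E v \<mu> w) \<and>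
     \<not> (card (verts E) = 1 \<and> arcs E = {})"

definition primitive_graph :: "('v, 'e) pre_digraph \<Rightarrow> bool" where
  "primitive_graph E \<longleftrightarrow>
     (\<exists>n\<ge>1. \<forall>v\<in>verts E. \<forall>w\<in>verts E. \<exists>\<mu>. length \<mu> = n \<and> is_path E v \<mu> w)"

text \<open>
  A right-infinite path \<open>e\<^sub>1e\<^sub>2\<dots>\<close> is the sequence \<open>y\<close> with \<open>y i = e\<^bsub>i+1\<^esub>\<close>.
  A left-infinite path \<open>\<dots>e\<^bsub>-2\<^esub>e\<^bsub>-1\<^esub>\<close> is the sequence \<open>x\<close> with \<open>x k = e\<^bsub>-(k+1)\<^esub>\<close>, that is, it is
  read from right to left.
\<close>

definition right_inf_paths :: "('v, 'e) pre_digraph \<Rightarrow> (nat \<Rightarrow> 'e) set" where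
  "right_inf_paths E = {y. \<forall>i. y i \<in> arcs E \<and> tail E (y i) = head E (y (Suc i))}"

definition left_inf_paths :: "('v, 'e) pre_digraph \<Rightarrow> (nat \<Rightarrow> 'e) set" where
  "left_inf_paths E = {x. \<forall>k. x k \<in> arcs E \<and> tail E (x (Suc k)) = head E (x k)}"

definition bi_inf_paths :: "('v, 'e) pre_digraph \<Rightarrow> (int \<Rightarrow> 'e) set" where
  "bi_inf_paths E = {x. \<forall>n. x n \<in> arcs E \<and> tail E (x n) = head E (x (n + 1))}"

definition left_inf_topology :: "('v, 'e) pre_digraph \<Rightarrow> (nat \<Rightarrow> 'e) topology" where
  "left_inf_topology E = topology_generated_by
     {{x \<in> left_inf_paths E. \<forall>k<n. x k = z k} | z n. z \<in> left_inf_paths E}"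

definition bi_inf_topology :: "('v, 'e) pre_digraph \<Rightarrow> (int \<Rightarrow> 'e) topology" where
  "bi_inf_topology E = topology_generated_by
     {{x \<in> bi_inf_paths E. \<forall>k\<in>{m..n}. x k = z k} | z m n. z \<in> bi_inf_paths E}"

text \<open>The path \<open>x\<^bsub>-n\<^esub> \<dots> x\<^bsub>-1\<^esub>\<close>.\<close>

definition left_segment :: "(nat \<Rightarrow> 'e) \<Rightarrow> nat \<Rightarrow> 'e list" where
  "left_segment x n = rev (map x [0..<n])"

definition left_shift :: "(nat \<Rightarrow> 'e) \<Rightarrow> nat \<Rightarrow> 'e" where
  "left_shift x = (\<lambda>k. x (Suc k))"

definition bi_shift :: "(int \<Rightarrow> 'e) \<Rightarrow> int \<Rightarrow> 'e" where
  "bi_shift x = (\<lambda>n. x (n - 1))"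

text \<open>\<open>left_half x n\<close> is \<open>x(-\<infinity>,n)\<close> and \<open>right_half x n\<close> is \<open>x\<^sub>nx\<^bsub>n+1\<^esub>\<dots>\<close>.\<close>

definition left_half :: "(int \<Rightarrow> 'e) \<Rightarrow> int \<Rightarrow> nat \<Rightarrow> 'e" where
  "left_half x n = (\<lambda>k. x (n - int k))"

definition right_half :: "(int \<Rightarrow> 'e) \<Rightarrow> int \<Rightarrow> nat \<Rightarrow> 'e" where
  "right_half x n = (\<lambda>k. x (n + int k))"


section \<open>Self-similar groupoid actions\<close>

text \<open>
  The unit space is identified with a set \<open>V\<close> of vertices through \<open>gunit\<close>;
  \<open>gmult G g h\<close> is the product \<open>gh\<close>, defined when \<open>d(g) = c(h)\<close>.
\<close>

record ('g, 'v) groupoid_data =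
  garrows :: "'g set"
  gdom :: "'g \<Rightarrow> 'v"
  gcod :: "'g \<Rightarrow> 'v"
  gunit :: "'v \<Rightarrow> 'g"
  gmult :: "'g \<Rightarrow> 'g \<Rightarrow> 'g"

locale groupoid =
  fixes G :: "('g, 'v) groupoid_data" and V :: "'v set"
  assumes dom_in: "g \<in> garrows G \<Longrightarrow> gdom G g \<in> V"
    and cod_in: "g \<in> garrows G \<Longrightarrow> gcod G g \<in> V"
    and unit_in: "v \<in> V \<Longrightarrow> gunit G v \<in> garrows G"
    and dom_unit: "v \<in> V \<Longrightarrow> gdom G (gunit G v) = v"
    and cod_unit: "v \<in> V \<Longrightarrow> gcod G (gunit G v) = v"
    and mult_in: "\<lbrakk>g \<in> garrows G; h \<in> garrows G; gdom G g = gcod G h\<rbrakk>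
          \<Longrightarrow> gmult G g h \<in> garrows G"
    and dom_mult: "\<lbrakk>g \<in> garrows G; h \<in> garrows G; gdom G g = gcod G h\<rbrakk>
          \<Longrightarrow> gdom G (gmult G g h) = gdom G h"
    and cod_mult: "\<lbrakk>g \<in> garrows G; h \<in> garrows G; gdom G g = gcod G h\<rbrakk>
          \<Longrightarrow> gcod G (gmult G g h) = gcod G g"
    and assoc: "\<lbrakk>g \<in> garrows G; h \<in> garrows G; k \<in> garrows G;
           gdom G g = gcod G h; gdom G h = gcod G k\<rbrakk>
          \<Longrightarrow> gmult G (gmult G g h) k = gmult G g (gmult G h k)"
    and unit_right: "g \<in> garrows G \<Longrightarrow> gmult G g (gunit G (gdom G g)) = g"
    and unit_left: "g \<in> garrows G \<Longrightarrow> gmult G (gunit G (gcod G g)) g = g"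
    and inverse: "g \<in> garrows G \<Longrightarrow>
          \<exists>h\<in>garrows G. gdom G h = gcod G g \<and> gcod G h = gdom G g \<and>
            gmult G h g = gunit G (gdom G g) \<and> gmult G g h = gunit G (gcod G g)"

definition partial_isomorphism ::
  "('v, 'e) pre_digraph \<Rightarrow> 'v \<Rightarrow> 'v \<Rightarrow> ('e list \<Rightarrow> 'e list) \<Rightarrow> bool" where
  "partial_isomorphism E v w f \<longleftrightarrow>
     bij_betw f (paths_to E v) (paths_to E w) \<and>
     (\<forall>\<mu>\<in>paths_to E v. length (f \<mu>) = length \<mu>) \<and>
     (\<forall>\<mu> e. \<mu> @ [e] \<in> paths_to E v \<longrightarrow> (\<exists>e'. f (\<mu> @ [e]) = f \<mu> @ [e']))"

text \<open>\<open>is_restriction E G act g e h\<close> says that \<open>h\<close> has the properties required of \<open>g|\<^sub>e\<close>.\<close>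

definition is_restriction ::
  "('v, 'e) pre_digraph \<Rightarrow> ('g, 'v) groupoid_data \<Rightarrow> ('g \<Rightarrow> 'e list \<Rightarrow> 'e list)
    \<Rightarrow> 'g \<Rightarrow> 'e \<Rightarrow> 'g \<Rightarrow> bool" where
  "is_restriction E G act g e h \<longleftrightarrow>
     h \<in> garrows G \<and> gdom G h = tail E e \<and> gcod G h = tail E (hd (act g [e])) \<and>
     (\<forall>\<mu>\<in>paths_to E (tail E e). act g (e # \<mu>) = act g [e] @ act h \<mu>)"

text \<open>
  The assumptions \<open>act_piso\<close>, \<open>act_unit\<close>, \<open>act_mult\<close> and \<open>act_inj\<close> say that \<open>act\<close> is an injective
  homomorphism into the groupoid of partial isomorphisms that is the identity on units.
  The values of \<open>act g\<close> outside the paths with range \<open>d(g)\<close> are irrelevant.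
\<close>

locale self_similar_action = wf_digraph E + groupoid G "verts E"
  for E :: "('v, 'e) pre_digraph" and G :: "('g, 'v) groupoid_data" +
  fixes act :: "'g \<Rightarrow> 'e list \<Rightarrow> 'e list"
  assumes act_piso: "g \<in> garrows G \<Longrightarrow> partial_isomorphism E (gdom G g) (gcod G g) (act g)"
    and act_unit: "\<lbrakk>v \<in> verts E; \<mu> \<in> paths_to E v\<rbrakk> \<Longrightarrow> act (gunit G v) \<mu> = \<mu>"
    and act_mult: "\<lbrakk>g \<in> garrows G; h \<in> garrows G; gdom G g = gcod G h; \<mu> \<in> paths_to E (gdom G h)\<rbrakk>
          \<Longrightarrow> act (gmult G g h) \<mu> = act g (act h \<mu>)"
    and act_inj: "\<lbrakk>g \<in> garrows G; h \<in> garrows G; gdom G g = gdom G h; gcod G g = gcod G h;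
           \<And>\<mu>. \<mu> \<in> paths_to E (gdom G g) \<Longrightarrow> act g \<mu> = act h \<mu>\<rbrakk> \<Longrightarrow> g = h"
    and restriction_exists: "\<lbrakk>g \<in> garrows G; e \<in> in_arcs E (gdom G g)\<rbrakk>
          \<Longrightarrow> \<exists>h. is_restriction E G act g e h"

definition edge_restr ::
  "('v, 'e) pre_digraph \<Rightarrow> ('g, 'v) groupoid_data \<Rightarrow> ('g \<Rightarrow> 'e list \<Rightarrow> 'e list)
    \<Rightarrow> 'g \<Rightarrow> 'e \<Rightarrow> 'g" where
  "edge_restr E G act g e = (THE h. is_restriction E G act g e h)"

primrec path_restr ::
  "('v, 'e) pre_digraph \<Rightarrow> ('g, 'v) groupoid_data \<Rightarrow> ('g \<Rightarrow> 'e list \<Rightarrow> 'e list)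
    \<Rightarrow> 'g \<Rightarrow> 'e list \<Rightarrow> 'g" where
  "path_restr E G act g [] = g"
| "path_restr E G act g (e # \<mu>) = path_restr E G act (edge_restr E G act g e) \<mu>"

text \<open>
  The action on right-infinite paths: the \<open>n\<close>-th edge of \<open>g \<cdot> y\<close> is the last edge of the image
  of the initial segment of \<open>y\<close> of length \<open>n + 1\<close>.
\<close>

definition act_inf :: "('g \<Rightarrow> 'e list \<Rightarrow> 'e list) \<Rightarrow> 'g \<Rightarrow> (nat \<Rightarrow> 'e) \<Rightarrow> nat \<Rightarrow> 'e" where
  "act_inf act g y = (\<lambda>n. act g (map y [0..<Suc n]) ! n)"

definition contracting ::
  "('v, 'e) pre_digraph \<Rightarrow> ('g, 'v) groupoid_data \<Rightarrow> ('g \<Rightarrow> 'e list \<Rightarrow> 'e list) \<Rightarrow> bool" where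
  "contracting E G act \<longleftrightarrow>
     (\<exists>F. finite F \<and> F \<subseteq> garrows G \<and>
        (\<forall>g\<in>garrows G. \<exists>n. {path_restr E G act g \<mu> | \<mu>. \<mu> \<in> paths_to E (gdom G g) \<and> length \<mu> = n} \<subseteq> F))"

definition regular_action ::
  "('v, 'e) pre_digraph \<Rightarrow> ('g, 'v) groupoid_data \<Rightarrow> ('g \<Rightarrow> 'e list \<Rightarrow> 'e list) \<Rightarrow> bool" where
  "regular_action E G act \<longleftrightarrow>
     (\<forall>g\<in>garrows G. \<forall>y\<in>right_inf_paths E.
        head E (y 0) = gdom G g \<and> act_inf act g y = y \<longrightarrow>
        (\<exists>n. let \<mu> = map y [0..<n] in
           act g \<mu> = \<mu> \<and> path_restr E G act g \<mu> = gunit G (path_source E (gdom G g) \<mu>)))"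


section \<open>Limit space and limit solenoid\<close>

definition quotient_topology :: "'a topology \<Rightarrow> ('a \<times> 'a) set \<Rightarrow> 'a set topology" where
  "quotient_topology X R =
     topology (\<lambda>U. U \<subseteq> topspace X // R \<and> openin X {x \<in> topspace X. R `` {x} \<in> U})"

lemma openin_quotient_topology:
  "openin (quotient_topology X R) U \<longleftrightarrow>
     U \<subseteq> topspace X // R \<and> openin X {x \<in> topspace X. R `` {x} \<in> U}"
proof -
  have inter: "{x \<in> topspace X. R `` {x} \<in> S \<inter> T} =
      {x \<in> topspace X. R `` {x} \<in> S} \<inter> {x \<in> topspace X. R `` {x} \<in> T}" for S T
    by blast
  have union: "{x \<in> topspace X. R `` {x} \<in> \<Union>\<K>} = (\<Union>K\<in>\<K>. {x \<in> topspace X. R `` {x} \<in> K})" for \<K>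
    by blast
  have "istopology (\<lambda>U. U \<subseteq> topspace X // R \<and> openin X {x \<in> topspace X. R `` {x} \<in> U})"
    unfolding istopology_def
  proof (intro conjI allI impI; (elim conjE)?)
    fix S T
    assume S: "S \<subseteq> topspace X // R"
      and openins: "openin X {x \<in> topspace X. R `` {x} \<in> S}" "openin X {x \<in> topspace X. R `` {x} \<in> T}"
    show "S \<inter> T \<subseteq> topspace X // R"
      by (rule le_infI1) (rule S)
    show "openin X {x \<in> topspace X. R `` {x} \<in> S \<inter> T}"
      unfolding inter by (rule openin_Int) (rule openins)+
  next
    fix \<K>
    assume K: "\<forall>K\<in>\<K>. K \<subseteq> topspace X // R \<and> openin X {x \<in> topspace X. R `` {x} \<in> K}"
    show "\<Union>\<K> \<subseteq> topspace X // R"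
      by (rule Union_least) (use K in fast)
    show "openin X {x \<in> topspace X. R `` {x} \<in> \<Union>\<K>}"
      unfolding union by (rule openin_Union) (use K in fast)
  qed
  then show ?thesis
    unfolding quotient_topology_def by (subst topology_inverse') (assumption, rule refl)
qed

lemma topspace_quotient_topology: "topspace (quotient_topology X R) = topspace X // R"
proof
  show "topspace (quotient_topology X R) \<subseteq> topspace X // R"
    by (rule conjunct1[OF openin_quotient_topology[THEN iffD1, OF openin_topspace]])
  have "{x \<in> topspace X. R `` {x} \<in> topspace X // R} = topspace X"
    by (auto intro: quotientI)
  then have "openin (quotient_topology X R) (topspace X // R)"
    unfolding openin_quotient_topology by simp
  then show "topspace X // R \<subseteq> topspace (quotient_topology X R)"
    by (rule openin_subset)
qed

lemma quotient_map_quotient_topology: "quotient_map X (quotient_topology X R) (\<lambda>x. R `` {x})"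
proof -
  have "(\<lambda>x. R `` {x}) ` topspace X = topspace X // R"
    unfolding quotient_def by blast
  then show ?thesis
    unfolding quotient_map_def topspace_quotient_topology openin_quotient_topology by simp
qed

text \<open>
  Asymptotic equivalence.  In \<open>ae_left\<close>, \<open>g k\<close> stands for \<open>g\<^sub>n\<close> with \<open>n = -(k+1)\<close>; that
  \<open>g\<^sub>n\<close> acts on a path includes that its domain is the range of that path.
\<close>

definition ae_left ::
  "('v, 'e) pre_digraph \<Rightarrow> ('g, 'v) groupoid_data \<Rightarrow> ('g \<Rightarrow> 'e list \<Rightarrow> 'e list)
    \<Rightarrow> ((nat \<Rightarrow> 'e) \<times> (nat \<Rightarrow> 'e)) set" where
  "ae_left E G act =
     {(x, y). x \<in> left_inf_paths E \<and> y \<in> left_inf_paths E \<and>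
        (\<exists>g. finite (range g) \<and>
           (\<forall>k. g k \<in> garrows G \<and> gdom G (g k) = head E (x k) \<and>
                act (g k) (left_segment x (Suc k)) = left_segment y (Suc k)))}"

definition ae_bi ::
  "('v, 'e) pre_digraph \<Rightarrow> ('g, 'v) groupoid_data \<Rightarrow> ('g \<Rightarrow> 'e list \<Rightarrow> 'e list)
    \<Rightarrow> ((int \<Rightarrow> 'e) \<times> (int \<Rightarrow> 'e)) set" where
  "ae_bi E G act =
     {(x, y). x \<in> bi_inf_paths E \<and> y \<in> bi_inf_paths E \<and>
        (\<exists>g. finite (range g) \<and>
           (\<forall>n. g n \<in> garrows G \<and> gdom G (g n) = head E (x n) \<and>
                act_inf act (g n) (right_half x n) = right_half y n))}"

definition limit_space ::
  "('v, 'e) pre_digraph \<Rightarrow> ('g, 'v) groupoid_data \<Rightarrow> ('g \<Rightarrow> 'e list \<Rightarrow> 'e list)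
    \<Rightarrow> (nat \<Rightarrow> 'e) set topology" where
  "limit_space E G act = quotient_topology (left_inf_topology E) (ae_left E G act)"

definition limit_solenoid ::
  "('v, 'e) pre_digraph \<Rightarrow> ('g, 'v) groupoid_data \<Rightarrow> ('g \<Rightarrow> 'e list \<Rightarrow> 'e list)
    \<Rightarrow> (int \<Rightarrow> 'e) set topology" where
  "limit_solenoid E G act = quotient_topology (bi_inf_topology E) (ae_bi E G act)"

abbreviation left_class ::
  "('v, 'e) pre_digraph \<Rightarrow> ('g, 'v) groupoid_data \<Rightarrow> ('g \<Rightarrow> 'e list \<Rightarrow> 'e list)
    \<Rightarrow> (nat \<Rightarrow> 'e) \<Rightarrow> (nat \<Rightarrow> 'e) set" where
  "left_class E G act x \<equiv> ae_left E G act `` {x}"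

abbreviation bi_class ::
  "('v, 'e) pre_digraph \<Rightarrow> ('g, 'v) groupoid_data \<Rightarrow> ('g \<Rightarrow> 'e list \<Rightarrow> 'e list)
    \<Rightarrow> (int \<Rightarrow> 'e) \<Rightarrow> (int \<Rightarrow> 'e) set" where
  "bi_class E G act x \<equiv> ae_bi E G act `` {x}"

text \<open>
  The map induced by the shift; since the shift respects \<open>ae_left\<close>, the union is over
  equal sets.
\<close>

definition limit_shift ::
  "('v, 'e) pre_digraph \<Rightarrow> ('g, 'v) groupoid_data \<Rightarrow> ('g \<Rightarrow> 'e list \<Rightarrow> 'e list)
    \<Rightarrow> (nat \<Rightarrow> 'e) set \<Rightarrow> (nat \<Rightarrow> 'e) set" where
  "limit_shift E G act a = (\<Union>x\<in>a. left_class E G act (left_shift x))"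


section \<open>Smale spaces\<close>

text \<open>
  The values of \<open>br\<close> on pairs at distance more than \<open>\<epsilon>\<close> are irrelevant; an equation involving
  brackets is required when the brackets on both of its sides are defined.
\<close>

locale smale_space =
  fixes X :: "'a metric" and \<phi> :: "'a \<Rightarrow> 'a" and \<epsilon> \<kappa> :: real and br :: "'a \<Rightarrow> 'a \<Rightarrow> 'a"
  assumes compact: "compact_space (mtopology_of X)"
    and homeomorphism: "homeomorphic_map (mtopology_of X) (mtopology_of X) \<phi>"
    and eps_pos: "0 < \<epsilon>"
    and ratio_pos: "0 < \<kappa>"
    and ratio_less_1: "\<kappa> < 1"
    and bracket_continuous:
      "continuous_map
         (subtopology (prod_topology (mtopology_of X) (mtopology_of X))
            {(x, y). mdist X x y \<le> \<epsilon>})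
         (mtopology_of X) (\<lambda>(x, y). br x y)"
    and bracket_self: "x \<in> mspace X \<Longrightarrow> br x x = x"
    and bracket_right:
      "\<lbrakk>x \<in> mspace X; y \<in> mspace X; z \<in> mspace X;
        mdist X y z \<le> \<epsilon>; mdist X x (br y z) \<le> \<epsilon>; mdist X x z \<le> \<epsilon>\<rbrakk>
       \<Longrightarrow> br x (br y z) = br x z"
    and bracket_left:
      "\<lbrakk>x \<in> mspace X; y \<in> mspace X; z \<in> mspace X;
        mdist X x y \<le> \<epsilon>; mdist X (br x y) z \<le> \<epsilon>; mdist X x z \<le> \<epsilon>\<rbrakk>
       \<Longrightarrow> br (br x y) z = br x z"
    and bracket_equivariant:
      "\<lbrakk>x \<in> mspace X; y \<in> mspace X; mdist X x y \<le> \<epsilon>; mdist X (\<phi> x) (\<phi> y) \<le> \<epsilon>\<rbrakk>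
       \<Longrightarrow> \<phi> (br x y) = br (\<phi> x) (\<phi> y)"
    and stable_contraction:
      "\<lbrakk>x \<in> mspace X; y \<in> mspace X; mdist X x y \<le> \<epsilon>; br x y = y\<rbrakk>
       \<Longrightarrow> mdist X (\<phi> x) (\<phi> y) \<le> \<kappa> * mdist X x y"
    and unstable_contraction:
      "\<lbrakk>x \<in> mspace X; y \<in> mspace X; mdist X x y \<le> \<epsilon>; br x y = x\<rbrakk>
       \<Longrightarrow> mdist X (inv_into (mspace X) \<phi> x) (inv_into (mspace X) \<phi> y) \<le> \<kappa> * mdist X x y"

definition stable_class :: "'a metric \<Rightarrow> ('a \<Rightarrow> 'a) \<Rightarrow> 'a \<Rightarrow> 'a set" where
  "stable_class X \<phi> x =
     {y \<in> mspace X. (\<lambda>n. mdist X ((\<phi> ^^ n) x) ((\<phi> ^^ n) y)) \<longlonglongrightarrow> 0}"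

definition local_stable_set :: "'a metric \<Rightarrow> ('a \<Rightarrow> 'a \<Rightarrow> 'a) \<Rightarrow> 'a \<Rightarrow> real \<Rightarrow> 'a set" where
  "local_stable_set X br y \<delta> = {z \<in> mspace X. mdist X y z < \<delta> \<and> br z y = y}"

definition stable_topology ::
  "'a metric \<Rightarrow> ('a \<Rightarrow> 'a) \<Rightarrow> real \<Rightarrow> ('a \<Rightarrow> 'a \<Rightarrow> 'a) \<Rightarrow> 'a \<Rightarrow> 'a topology" where
  "stable_topology X \<phi> \<epsilon> br x = topology_generated_by
     {local_stable_set X br y \<delta> | y \<delta>. y \<in> stable_class X \<phi> x \<and> 0 < \<delta> \<and> \<delta> < \<epsilon>}"

definition totally_disconnected_space :: "'a topology \<Rightarrow> bool" where
  "totally_disconnected_space T \<longleftrightarrow> (\<forall>S. connectedin T S \<longrightarrow> (\<exists>a. S \<subseteq> {a}))"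

definition totally_disconnected_stable_sets ::
  "'a metric \<Rightarrow> ('a \<Rightarrow> 'a) \<Rightarrow> real \<Rightarrow> ('a \<Rightarrow> 'a \<Rightarrow> 'a) \<Rightarrow> bool" where
  "totally_disconnected_stable_sets X \<phi> \<epsilon> br \<longleftrightarrow>
     (\<forall>x\<in>mspace X. totally_disconnected_space (stable_topology X \<phi> \<epsilon> br x))"

definition irreducible_system :: "'a topology \<Rightarrow> ('a \<Rightarrow> 'a) \<Rightarrow> bool" where
  "irreducible_system T \<phi> \<longleftrightarrow>
     (\<forall>U V. openin T U \<and> U \<noteq> {} \<and> openin T V \<and> V \<noteq> {} \<longrightarrow>
        (\<exists>N\<ge>1. (\<phi> ^^ N) ` U \<inter> V \<noteq> {}))"

definition mixing_system :: "'a topology \<Rightarrow> ('a \<Rightarrow> 'a) \<Rightarrow> bool" where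
  "mixing_system T \<phi> \<longleftrightarrow>
     (\<forall>U V. openin T U \<and> U \<noteq> {} \<and> openin T V \<and> V \<noteq> {} \<longrightarrow>
        (\<exists>N. \<forall>n\<ge>N. (\<phi> ^^ n) ` U \<inter> V \<noteq> {}))"

end

(* The solenoid is the inverse limit of the limit space along the induced shift: the coordinates
   [x] |-> [x(-oo,m)] are well defined and jointly injective because an asymptotic equivalence may be
   realised by arrows of a finite nucleus, and jointly surjective by compactness.  For an inverse
   limit of a locally expanding map, [x,y] is the unique point that has the zeroth coordinate of x
   and all of whose coordinates are close to those of y; it is built by lifting the zeroth
   coordinate step by step through the images of balls.  Irreducibility and mixing follow by joining
   two finite segments of bi-infinite paths by a path of the graph. *)

theory Submission
  imports Defs
begin

section \<open>Inverse limits of locally expanding maps\<close>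

text \<open>The metric argument sees the solenoid only as a compact space with coordinates
  \<open>p m\<close>. The Hausdorff property comes from the metric on it, and joint surjectivity of
  the coordinates from that of each one.

  The obstacle is that \<open>s\<close> expands only pairs closer than \<open>\<epsilon>\<close>. A
  coordinate can be controlled only after all earlier ones are known to be within
  \<open>\<epsilon>\<close>; its distance is then exactly \<open>(1 / c) ^ m\<close> times the
  zeroth one. This explains the constants: candidates for the bracket stay within
  \<open>\<epsilon> / 2\<close> of the second argument, so two of them are within
  \<open>\<epsilon>\<close> and coincide. The Smale constant \<open>\<epsilon> / 8\<close> leaves
  room to chain brackets and to compare brackets of nearby pairs.

  On the side of the graph the obstacle is one of quantifiers: equivalence of all left halves gives
  a sequence of arrows for each \<open>m\<close>, with no common finite set of values. A finite set
  that absorbs all deep restrictions provides one, and a pigeonhole argument then finds arrows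
  independent of \<open>m\<close>.\<close>

locale natural_extension =
  fixes T :: "'s topology" and J :: "'a metric" and s :: "'a \<Rightarrow> 'a"
    and p :: "nat \<Rightarrow> 's \<Rightarrow> 'a" and \<phi> :: "'s \<Rightarrow> 's" and \<epsilon> c :: real
  assumes compact_T: "compact_space T"
    and cont_p: "continuous_map T (mtopology_of J) (p m)"
    and p_shift: "z \<in> topspace T \<Longrightarrow> s (p (Suc m) z) = p m z"
    and p_inj: "\<lbrakk>x \<in> topspace T; y \<in> topspace T; \<And>m. p m x = p m y\<rbrakk> \<Longrightarrow> x = y"
    and p_onto: "a \<in> mspace J \<Longrightarrow> \<exists>z\<in>topspace T. p m z = a"
    and homeo: "homeomorphic_map T T \<phi>"
    and p_0: "z \<in> topspace T \<Longrightarrow> p 0 (\<phi> z) = s (p 0 z)"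
    and p_Suc: "z \<in> topspace T \<Longrightarrow> p (Suc m) (\<phi> z) = p m z"
    and e_pos: "0 < \<epsilon>" and c_gt_1: "1 < c"
    and expand: "\<lbrakk>a \<in> mspace J; b \<in> mspace J; mdist J a b < \<epsilon>\<rbrakk>
      \<Longrightarrow> mdist J (s a) (s b) = c * mdist J a b"
    and ball_image: "\<lbrakk>a \<in> mspace J; 0 < \<alpha>; \<alpha> \<le> \<epsilon>\<rbrakk>
      \<Longrightarrow> s ` mball_of J a \<alpha> = mball_of J (s a) (c * \<alpha>)"
begin

section \<open>The supremum metric and its topology\<close>

abbreviation S where "S \<equiv> topspace T"
abbreviation dist_p where "dist_p m x y \<equiv> mdist J (p m x) (p m y)"

text \<open>The weights are fitted to \<open>\<phi>\<close>, which by \<open>p_Suc\<close> moves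
  every coordinate one index up and so multiplies its term by \<open>1 / c\<close>.\<close>

definition ext_dist :: "'s \<Rightarrow> 's \<Rightarrow> real" where
  "ext_dist x y = (SUP m. (1 / c) ^ m * dist_p m x y)"

sublocale J: Metric_space "mspace J" "mdist J"
  by simp

lemma p_in [simp]: "x \<in> S \<Longrightarrow> p m x \<in> mspace J"
  using cont_p[of m] by (auto simp: continuous_map_def)

lemma s_in: "a \<in> mspace J \<Longrightarrow> s a \<in> mspace J"
proof -
  assume "a \<in> mspace J"
  then obtain z where z: "z \<in> S" "p (Suc 0) z = a"
    using p_onto by blast
  then show ?thesis
    using p_shift[OF z(1), of 0] p_in[OF z(1), of 0] by simp
qed

lemma phi_in [simp]: "x \<in> S \<Longrightarrow> \<phi> x \<in> S"
  using homeo homeomorphic_imp_surjective_map by blast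

lemma ratio: "0 < 1 / c" "1 / c < 1" "0 < c"
  using c_gt_1 by auto

lemma ratio_pow: "0 < (1 / c) ^ m" "(1 / c) ^ m \<le> 1"
  using ratio by (auto intro: power_le_one simp del: divide_eq_1_iff)

lemma ratio_pow_mult_le: "0 \<le> r \<Longrightarrow> (1 / c) ^ m * r \<le> r"
  using ratio_pow[of m] mult_right_mono[of "(1/c)^m" 1 r] by simp

lemma bounded_J:
  obtains B where "B > 0" "\<And>x y. x \<in> S \<Longrightarrow> y \<in> S \<Longrightarrow> dist_p m x y \<le> B"
proof -
  have "compactin (mtopology_of J) (p m ` S)"
    using image_compactin[OF _ cont_p] compact_T unfolding compact_space_def by blast
  then have "J.mbounded (p m ` S)"
    using J.compactin_imp_mbounded by (simp add: mtopology_of_def)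
  then show ?thesis
    unfolding J.mbounded_alt_pos using that by auto
qed

lemma p_image: "p m ` S = mspace J"
  using p_onto[of _ m] p_in[of _ m] by (blast intro: rev_image_eqI)

text \<open>\<open>bounded_J\<close> lets the bound depend on \<open>m\<close>. All coordinates have
  the same image, the whole of \<open>mspace J\<close>, so the bound for \<open>m = 0\<close> serves
  for every \<open>m\<close>.\<close>

lemma bounded_J_all:
  obtains B where "B > 0" "\<And>m x y. x \<in> S \<Longrightarrow> y \<in> S \<Longrightarrow> dist_p m x y \<le> B"
proof -
  obtain B where B: "B > 0" "\<And>x y. x \<in> S \<Longrightarrow> y \<in> S \<Longrightarrow> dist_p 0 x y \<le> B"
    using bounded_J by blast
  have "mdist J a b \<le> B" if "a \<in> mspace J" "b \<in> mspace J" for a b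
    using that B(2) unfolding p_image[of 0, symmetric] by auto
  then show ?thesis
    by (intro that[OF B(1)]) auto
qed

lemma bdd_ext_dist:
  assumes "x \<in> S" "y \<in> S"
  shows "bdd_above (range (\<lambda>m. (1 / c) ^ m * dist_p m x y))"
proof -
  obtain B where B: "B > 0" "\<And>m x y. x \<in> S \<Longrightarrow> y \<in> S \<Longrightarrow> dist_p m x y \<le> B"
    using bounded_J_all by blast
  have "(1 / c) ^ m * dist_p m x y \<le> B" for m
    using ratio_pow_mult_le[of "dist_p m x y" m] B(2)[OF assms, of m] by simp
  then show ?thesis
    by (rule bdd_aboveI2)
qed

lemma le_ext_dist: "x \<in> S \<Longrightarrow> y \<in> S \<Longrightarrow> (1 / c) ^ m * dist_p m x y \<le> ext_dist x y"
  unfolding ext_dist_def by (rule cSUP_upper[OF _ bdd_ext_dist]) auto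

lemma dist_0_le_ext_dist: "x \<in> S \<Longrightarrow> y \<in> S \<Longrightarrow> dist_p 0 x y \<le> ext_dist x y"
  using le_ext_dist[of x y 0] by simp

lemma ext_dist_le: "(\<And>m. (1 / c) ^ m * dist_p m x y \<le> r) \<Longrightarrow> ext_dist x y \<le> r"
  unfolding ext_dist_def by (rule cSUP_least) auto

lemma dist_le_ext_dist: "x \<in> S \<Longrightarrow> y \<in> S \<Longrightarrow> dist_p m x y \<le> c ^ m * ext_dist x y"
  using le_ext_dist[of x y m] ratio(3) by (simp add: field_simps power_divide)

text \<open>Outside \<open>S\<close> the supremum may range over an unbounded set and has no known
  sign, while \<open>Metric_space\<close> asks for nonnegativity at all arguments; hence the default
  value 0 there.\<close>

lemma metric_ext_dist: "Metric_space S (\<lambda>x y. if x \<in> S \<and> y \<in> S then ext_dist x y else 0)"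
  (is "Metric_space S ?ext_dist")
proof
  fix x y
  have nn: "0 \<le> ext_dist x y" if "x \<in> S" "y \<in> S" for x y
    using dist_0_le_ext_dist[OF that] mdist_nonneg[of J "p 0 x" "p 0 y"] by linarith
  then show "0 \<le> ?ext_dist x y" by auto
  show "?ext_dist x y = ?ext_dist y x"
    by (simp add: ext_dist_def mdist_commute)
  show "?ext_dist x y = 0 \<longleftrightarrow> x = y" if "x \<in> S" "y \<in> S"
  proof
    assume "?ext_dist x y = 0"
    then have "dist_p m x y \<le> 0" for m
      using dist_le_ext_dist[OF that, of m] that by simp
    then have "p m x = p m y" for m
      using that mdist_nonneg[of J "p m x" "p m y"] mdist_zero[of "p m x" J "p m y"]
      by (simp add: order_antisym)
    then show "x = y"
      using that by (rule p_inj[rotated 2])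
  next
    assume "x = y"
    then have "ext_dist x y \<le> 0"
      using that by (intro ext_dist_le) simp
    then show "?ext_dist x y = 0"
      using that nn[OF that] by simp
  qed
  fix z assume xyz: "x \<in> S" "y \<in> S" "z \<in> S"
  have "ext_dist x z \<le> ext_dist x y + ext_dist y z"
  proof (rule ext_dist_le)
    fix m
    have "(1 / c) ^ m * dist_p m x z \<le> (1 / c) ^ m * (dist_p m x y + dist_p m y z)"
      using xyz ratio_pow[of m] by (intro mult_left_mono mdist_triangle) auto
    also have "\<dots> = (1 / c) ^ m * dist_p m x y + (1 / c) ^ m * dist_p m y z"
      by (rule distrib_left)
    also have "\<dots> \<le> ext_dist x y + ext_dist y z"
      by (intro add_mono le_ext_dist xyz)
    finally show "(1 / c) ^ m * dist_p m x z \<le> ext_dist x y + ext_dist y z" .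
  qed
  then show "?ext_dist x z \<le> ?ext_dist x y + ?ext_dist y z"
    using xyz by simp
qed

definition dS :: "'s metric" where
  "dS = metric (S, \<lambda>x y. if x \<in> S \<and> y \<in> S then ext_dist x y else 0)"

lemma mspace_dS [simp]: "mspace dS = S"
  unfolding dS_def by (rule Metric_space.mspace_metric[OF metric_ext_dist])

lemma mdist_dS [simp]: "x \<in> S \<Longrightarrow> y \<in> S \<Longrightarrow> mdist dS x y = ext_dist x y"
  unfolding dS_def by (simp add: Metric_space.mdist_metric[OF metric_ext_dist])

lemma metric_dS: "Metric_space S (mdist dS)"
  using Metric_space_mspace_mdist[of dS] by simp

lemma ext_dist_commute: "ext_dist x y = ext_dist y x"
  by (simp add: ext_dist_def mdist_commute)

lemma small_ratio:
  assumes "r > 0"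
  obtains k where "\<And>m. m \<ge> k \<Longrightarrow> (1 / c) ^ m * B < (r::real)"
proof -
  \<comment> \<open>\<open>B\<close> may be zero or negative; \<open>\<bar>B\<bar> + 1\<close> is an
    upper bound for it by which one can divide.\<close>
  obtain k where k: "(1 / c) ^ k < r / (\<bar>B\<bar> + 1)"
    using real_arch_pow_inv[of "r / (\<bar>B\<bar> + 1)" "1 / c"] assms ratio by auto
  have "(1 / c) ^ m * B < r" if "m \<ge> k" for m
  proof -
    have "(1 / c) ^ m * B \<le> (1 / c) ^ m * (\<bar>B\<bar> + 1)"
      using ratio_pow[of m] by (intro mult_left_mono) auto
    also have "\<dots> \<le> (1 / c) ^ k * (\<bar>B\<bar> + 1)"
      using that ratio by (intro mult_right_mono power_decreasing) auto
    also have "\<dots> < r"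
      using k by (simp add: pos_less_divide_eq)
    finally show ?thesis .
  qed
  then show ?thesis using that by blast
qed

text \<open>The coordinates share a bound \<open>B\<close>, so terms beyond some \<open>k\<close>
  are small by their weights alone, and a neighbourhood has to control only finitely many
  coordinates.\<close>

lemma cont_id: "continuous_map T (mtopology_of dS) id"
  unfolding mtopology_of_def Metric_space.continuous_map_to_metric[OF Metric_space_mspace_mdist]
proof (intro ballI allI impI)
  fix x and r :: real assume x: "x \<in> S" and r: "0 < r"
  obtain B where B: "B > 0" "\<And>m x y. x \<in> S \<Longrightarrow> y \<in> S \<Longrightarrow> dist_p m x y \<le> B"
    using bounded_J_all by blast
  obtain k where k: "\<And>m. m \<ge> k \<Longrightarrow> (1 / c) ^ m * B < r / 2"
    using small_ratio[of "r / 2" B] r by auto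
  \<comment> \<open>Half of \<open>r\<close>, because a supremum of terms below a bound is only
    known to be at most that bound.\<close>
  define U where "U = (\<Inter>m\<in>{..k}. {y \<in> S. p m y \<in> mball_of J (p m x) (r / 2)})"
  have "openin T U"
    unfolding U_def
    by (intro openin_INT2 openin_continuous_map_preimage[OF cont_p])
      (auto simp: mtopology_of_def mball_of_def)
  moreover have "x \<in> U"
    using x r by (auto simp: U_def mball_of_def)
  moreover have "id y \<in> Metric_space.mball (mspace dS) (mdist dS) (id x) r" if "y \<in> U" for y
  proof -
    have y: "y \<in> S" and close: "\<And>m. m \<le> k \<Longrightarrow> dist_p m x y < r / 2"
      using that by (auto simp: U_def mball_of_def)
    have "(1 / c) ^ m * dist_p m x y \<le> r / 2" for m
    proof (cases "m \<le> k")
      case True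
      then show ?thesis
        using close[of m] ratio_pow_mult_le[of "dist_p m x y" m] by simp
    next
      case False
      have "(1 / c) ^ m * dist_p m x y \<le> (1 / c) ^ m * B"
        using B(2)[OF x y, of m] ratio_pow[of m] by (intro mult_left_mono) auto
      then show ?thesis
        using k[of m] False by simp
    qed
    then have "ext_dist x y \<le> r / 2" by (rule ext_dist_le)
    then show ?thesis
      using x y r by (simp add: Metric_space.in_mball[OF metric_dS])
  qed
  ultimately show "\<exists>U. openin T U \<and> x \<in> U \<and>
      (\<forall>y\<in>U. id y \<in> Metric_space.mball (mspace dS) (mdist dS) (id x) r)"
    by blast
qed

text \<open>The identity is a continuous bijection from a compact space to a Hausdorff space, hence
  a homeomorphism.\<close>

lemma mtopology_dS: "mtopology_of dS = T"
proof -
  have "homeomorphic_map T (mtopology_of dS) id"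
    using compact_T cont_id
    by (intro continuous_imp_homeomorphic_map)
      (auto simp: mtopology_of_def Metric_space.Hausdorff_space_mtopology[OF metric_dS]
        Metric_space.topspace_mtopology[OF metric_dS])
  then have "openin T U \<longleftrightarrow> U \<subseteq> S \<and> openin (mtopology_of dS) U" for U
    using homeomorphic_map_openness_eq[of T "mtopology_of dS" id U] by simp
  moreover have "openin (mtopology_of dS) U \<Longrightarrow> U \<subseteq> S" for U
    using openin_subset[of "mtopology_of dS" U] by simp
  ultimately show ?thesis
    unfolding topology_eq by blast
qed

section \<open>Lifting through the coordinates and the bracket\<close>

lemma p_surj:
  assumes a: "\<And>m. a m \<in> mspace J" and sa: "\<And>m. s (a (Suc m)) = a m"
  obtains z where "z \<in> S" "\<And>m. p m z = a m"
proof -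
  \<comment> \<open>\<open>p_onto\<close> realises one prescribed coordinate at a time. A point with
    the right coordinate \<open>Suc k\<close> also has the right coordinate \<open>k\<close>, so
    these fibres are nested and compactness yields a common point.\<close>
  define C where "C k = {z \<in> S. p k z \<in> {a k}}" for k
  have "closedin T (C k)" for k
    unfolding C_def
    by (rule closedin_continuous_map_preimage[OF cont_p])
      (simp add: mtopology_of_def closedin_Hausdorff_sing_eq[OF J.Hausdorff_space_mtopology] a)
  moreover have "C k \<noteq> {}" for k
    using p_onto[OF a, of k] unfolding C_def by auto
  moreover have "decseq C"
    unfolding decseq_Suc_iff
  proof
    fix k show "C (Suc k) \<subseteq> C k"
      using sa[of k] p_shift[of _ k] unfolding C_def by force
  qed
  ultimately have "(\<Inter>k. C k) \<noteq> {}"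
    using compact_space_imp_nest[OF compact_T] by blast
  then show ?thesis
    using that unfolding C_def by auto
qed

text \<open>Passing from \<open>m\<close> to \<open>Suc m\<close> undoes one application of
  \<open>s\<close>, which divides the distance by exactly \<open>c\<close> once the new pair is
  known to lie within \<open>\<epsilon>\<close>; hence the bound on every coordinate up to
  \<open>m\<close>.\<close>

lemma close_coordinates:
  assumes "x \<in> S" "y \<in> S" and "\<And>i. i \<le> m \<Longrightarrow> dist_p i x y < \<epsilon>"
  shows "dist_p m x y = (1 / c) ^ m * dist_p 0 x y"
  using assms(3)
proof (induction m)
  case (Suc m)
  have "dist_p m x y = c * dist_p (Suc m) x y"
    using expand[of "p (Suc m) x" "p (Suc m) y"] Suc.prems[of "Suc m"] assms(1,2)
    by (simp add: p_shift)
  moreover have "dist_p m x y = (1 / c) ^ m * dist_p 0 x y"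
    using Suc by simp
  ultimately show ?case
    using ratio by (simp add: field_simps)
qed simp

text \<open>Expansiveness, in the form that makes the bracket unique: distance 0 in coordinate 0
  propagates to all coordinates.\<close>

lemma close_imp_eq:
  assumes "x \<in> S" "y \<in> S" "p 0 x = p 0 y" "\<And>i. dist_p i x y < \<epsilon>"
  shows "x = y"
proof (rule p_inj)
  fix m
  have "dist_p m x y = 0"
    using close_coordinates[of x y m] assms by simp
  then show "p m x = p m y"
    using assms by simp
qed (use assms in auto)

lemma ex_bracket:
  assumes x: "x \<in> S" and y: "y \<in> S" and lt: "dist_p 0 x y < \<epsilon>"
  obtains z where "z \<in> S" "p 0 z = p 0 x" "\<And>m. dist_p m z y = (1 / c) ^ m * dist_p 0 x y"
proof -
  \<comment> \<open>The last conjunct anchors the sequence at \<open>p 0 x\<close>; it is part of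
    \<open>?P\<close> because \<open>dependent_nat_choice\<close> uses one predicate for all
    stages.\<close>
  let ?P = "\<lambda>m b. b \<in> mspace J \<and> mdist J b (p m y) = (1 / c) ^ m * dist_p 0 x y \<and> (m = 0 \<longrightarrow> b = p 0 x)"
  have "\<exists>a. \<forall>m. ?P m (a m) \<and> s (a (Suc m)) = a m"
  proof (rule dependent_nat_choice)
    show "\<exists>b. ?P 0 b" using x by auto
  next
    fix b m assume b: "?P m b"
    let ?y = "p (Suc m) y"
    have "mdist J b (p m y) < c * \<epsilon>"
    proof -
      have "mdist J b (p m y) \<le> dist_p 0 x y"
        using b ratio_pow_mult_le by simp
      also have "\<dots> < \<epsilon>" by (rule lt)
      also have "\<epsilon> \<le> c * \<epsilon>" using c_gt_1 e_pos by simp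
      finally show ?thesis .
    qed
    then have "b \<in> mball_of J (s ?y) (c * \<epsilon>)"
      using b y by (simp add: mball_of_def p_shift mdist_commute)
    then obtain b' where b': "b' \<in> mspace J" "mdist J ?y b' < \<epsilon>" "s b' = b"
      unfolding ball_image[OF p_in[OF y] e_pos order_refl, symmetric] by (auto simp: mball_of_def)
    \<comment> \<open>The ball gives a lift that is merely within \<open>\<epsilon>\<close> of
      \<open>?y\<close>; at that range \<open>s\<close> expands exactly, so the distance has in fact
      dropped by the factor \<open>c\<close>.\<close>
    have "mdist J b (p m y) = c * mdist J b' ?y"
      using expand[of b' ?y] b' y by (simp add: mdist_commute p_shift)
    then have "mdist J b' ?y = (1 / c) ^ Suc m * dist_p 0 x y"
      using b ratio by (simp add: field_simps)
    then show "\<exists>b'. ?P (Suc m) b' \<and> s b' = b"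
      using b' by auto
  qed
  then obtain a where a: "\<And>m. ?P m (a m)" "\<And>m. s (a (Suc m)) = a m"
    by blast
  obtain z where "z \<in> S" "\<And>m. p m z = a m"
    using p_surj[of a] a by blast
  then show ?thesis
    using that a(1) by auto
qed

text \<open>The bound \<open>\<epsilon> / 2\<close> puts two candidates less than
  \<open>\<epsilon>\<close> apart in every coordinate, where \<open>close_imp_eq\<close> applies.
  Only the zeroth coordinate of \<open>x\<close> occurs, which later makes
  \<open>br (br x y) z = br x z\<close> immediate.\<close>

definition br :: "'s \<Rightarrow> 's \<Rightarrow> 's" where
  "br x y = (SOME z. z \<in> S \<and> p 0 z = p 0 x \<and> (\<forall>m. dist_p m z y < \<epsilon> / 2))"

lemma br_unique:
  assumes "z \<in> S" "y \<in> S" "p 0 z = p 0 x" "\<And>m. dist_p m z y < \<epsilon> / 2"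
  shows "br x y = z"
  unfolding br_def
proof (rule some_equality)
  fix w assume w: "w \<in> S \<and> p 0 w = p 0 x \<and> (\<forall>m. dist_p m w y < \<epsilon> / 2)"
  have "dist_p m w z < \<epsilon>" for m
  proof -
    have "dist_p m w z \<le> dist_p m w y + dist_p m z y"
      using mdist_triangle[of "p m w" J "p m y" "p m z"] w assms(1,2)
      by (simp add: mdist_commute)
    moreover have "dist_p m w y < \<epsilon> / 2"
      using w by blast
    ultimately show ?thesis
      using assms(4)[of m] by linarith
  qed
  then show "w = z"
    using w assms by (intro close_imp_eq) auto
qed (use assms in auto)

lemma br_props:
  assumes "x \<in> S" "y \<in> S" "ext_dist x y \<le> \<epsilon> / 8"
  shows "br x y \<in> S" "p 0 (br x y) = p 0 x" "dist_p m (br x y) y = (1 / c) ^ m * dist_p 0 x y"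
    "dist_p m (br x y) y \<le> \<epsilon> / 8"
proof -
  have le: "dist_p 0 x y \<le> \<epsilon> / 8"
    using dist_0_le_ext_dist[OF assms(1,2)] assms(3) by simp
  then have "dist_p 0 x y < \<epsilon>"
    using e_pos by linarith
  then obtain z where z: "z \<in> S" "p 0 z = p 0 x" "\<And>m. dist_p m z y = (1 / c) ^ m * dist_p 0 x y"
    using ex_bracket[OF assms(1,2)] by metis
  have small: "dist_p m z y \<le> \<epsilon> / 8" for m
    using z(3)[of m] ratio_pow_mult_le[of "dist_p 0 x y" m] le by simp
  have "br x y = z"
    using z(1) assms(2) z(2)
  proof (rule br_unique)
    show "dist_p m z y < \<epsilon> / 2" for m
      using small[of m] e_pos by linarith
  qed
  then show "br x y \<in> S" "p 0 (br x y) = p 0 x" "dist_p m (br x y) y = (1 / c) ^ m * dist_p 0 x y"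
    "dist_p m (br x y) y \<le> \<epsilon> / 8"
    using z small by auto
qed

text \<open>If the zeroth coordinates agree, \<open>y\<close> itself is a candidate for the bracket.
  Locally, lying on the same stable set thus means having the same zeroth coordinate.\<close>

lemma br_eq_right_iff:
  assumes "x \<in> S" "y \<in> S" "ext_dist x y \<le> \<epsilon> / 8"
  shows "br x y = y \<longleftrightarrow> p 0 x = p 0 y"
proof
  assume "p 0 x = p 0 y"
  then show "br x y = y"
    using assms e_pos by (intro br_unique) auto
qed (use br_props[OF assms] in auto)

text \<open>The term of the images for coordinate 0 vanishes, and each later one is a term of the
  old supremum times \<open>1 / c\<close>.\<close>

lemma ext_dist_phi:
  assumes "x \<in> S" "y \<in> S" "p 0 x = p 0 y"
  shows "ext_dist (\<phi> x) (\<phi> y) \<le> 1 / c * ext_dist x y"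
proof (rule ext_dist_le)
  fix m
  show "(1 / c) ^ m * dist_p m (\<phi> x) (\<phi> y) \<le> 1 / c * ext_dist x y"
  proof (cases m)
    case 0
    have "0 \<le> ext_dist x y"
      using mdist_nonneg[of dS x y] assms by simp
    then show ?thesis
      using assms ratio 0 by (simp add: p_0 s_in)
  next
    case (Suc k)
    have "1 / c * ((1 / c) ^ k * dist_p k x y) \<le> 1 / c * ext_dist x y"
      using le_ext_dist[OF assms(1,2)] ratio by (intro mult_left_mono) auto
    then show ?thesis
      using assms Suc by (simp add: p_Suc)
  qed
qed

lemma inv_phi:
  assumes "x \<in> S"
  shows "inv_into S \<phi> x \<in> S" "p m (inv_into S \<phi> x) = p (Suc m) x"
proof -
  have im: "\<phi> ` S = S"
    using homeo homeomorphic_imp_surjective_map by blast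
  then show "inv_into S \<phi> x \<in> S"
    using assms by (metis inv_into_into)
  then show "p m (inv_into S \<phi> x) = p (Suc m) x"
    using p_Suc[of "inv_into S \<phi> x" m] f_inv_into_f[of x \<phi> S] im assms by simp
qed

text \<open>The inverse of \<open>\<phi>\<close> drops coordinate 0, which in general could enlarge
  distances. When \<open>br x y = x\<close> the coordinate distances decay geometrically, so
  coordinate 1 dominates what remains, and it is \<open>1 / c\<close> times coordinate 0.\<close>

lemma unstable_ext_dist:
  assumes "x \<in> S" "y \<in> S" "ext_dist x y \<le> \<epsilon> / 8" "br x y = x"
  shows "ext_dist (inv_into S \<phi> x) (inv_into S \<phi> y) \<le> 1 / c * ext_dist x y"
proof (rule ext_dist_le)
  fix m
  have "dist_p (Suc m) x y = (1 / c) ^ Suc m * dist_p 0 x y"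
    using br_props(3)[OF assms(1-3), of "Suc m"] assms(4) by simp
  then have "(1 / c) ^ m * dist_p (Suc m) x y = (1 / c) ^ m * (1 / c * ((1 / c) ^ m * dist_p 0 x y))"
    by simp
  also have "\<dots> \<le> 1 / c * ((1 / c) ^ m * dist_p 0 x y)"
    using ratio_pow[of m] ratio by (intro ratio_pow_mult_le) auto
  also have "\<dots> \<le> 1 / c * dist_p 0 x y"
    using ratio by (intro mult_left_mono ratio_pow_mult_le) auto
  also have "\<dots> \<le> 1 / c * ext_dist x y"
    using ratio by (intro mult_left_mono dist_0_le_ext_dist assms) auto
  finally show "(1 / c) ^ m * dist_p m (inv_into S \<phi> x) (inv_into S \<phi> y) \<le> 1 / c * ext_dist x y"
    using assms by (simp add: inv_phi)
qed

text \<open>Up to coordinate \<open>k\<close> the brackets follow \<open>y\<close> and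
  \<open>y'\<close>, which are close there, so \<open>close_coordinates\<close> reduces everything
  to coordinate 0, where the brackets agree with \<open>x\<close> and \<open>x'\<close>. Beyond
  \<open>k\<close> the weight suffices. The factor \<open>(1 / c) ^ k\<close> makes up for the loss
  of at most \<open>c ^ k\<close> in \<open>dist_le_ext_dist\<close>.\<close>

lemma br_continuous_estimate:
  assumes x: "x \<in> S" "y \<in> S" "ext_dist x y \<le> \<epsilon> / 8"
    and x': "x' \<in> S" "y' \<in> S" "ext_dist x' y' \<le> \<epsilon> / 8"
    and y: "ext_dist y y' < \<epsilon> / 4 * (1 / c) ^ k" and r: "ext_dist x x' \<le> r"
    and B: "(1 / c) ^ k * B \<le> r" "\<And>m x y. x \<in> S \<Longrightarrow> y \<in> S \<Longrightarrow> dist_p m x y \<le> B"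
  shows "ext_dist (br x y) (br x' y') \<le> r"
proof (rule ext_dist_le)
  note b = br_props[OF x] and b' = br_props[OF x']
  fix m
  show "(1 / c) ^ m * dist_p m (br x y) (br x' y') \<le> r"
  proof (cases "m \<le> k")
    case True
    have "dist_p i (br x y) (br x' y') < \<epsilon>" if "i \<le> m" for i
    proof -
      have "dist_p i y y' \<le> c ^ i * ext_dist y y'"
        by (intro dist_le_ext_dist x x')
      also have "\<dots> \<le> c ^ k * ext_dist y y'"
        using that True c_gt_1 mdist_nonneg[of dS y y'] x x'
        by (intro mult_right_mono power_increasing) auto
      also have "\<dots> < c ^ k * (\<epsilon> / 4 * (1 / c) ^ k)"
        using y ratio by (intro mult_strict_left_mono) auto
      also have "\<dots> = \<epsilon> / 4"
        using ratio by (simp add: power_divide)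
      finally have "dist_p i y y' < \<epsilon> / 4" .
      moreover have "dist_p i (br x y) (br x' y') \<le> dist_p i (br x y) y + dist_p i y (br x' y')"
        using b(1) b'(1) x by (intro mdist_triangle) auto
      moreover have "dist_p i y (br x' y') \<le> dist_p i y y' + dist_p i (br x' y') y'"
        using b'(1) x x' mdist_triangle[of "p i y" J "p i y'" "p i (br x' y')"]
        by (simp add: mdist_commute)
      ultimately show ?thesis
        using b(4)[of i] b'(4)[of i] e_pos by linarith
    qed
    then have "dist_p m (br x y) (br x' y') = (1 / c) ^ m * dist_p 0 (br x y) (br x' y')"
      using b(1) b'(1) by (intro close_coordinates) auto
    also have "\<dots> \<le> dist_p 0 (br x y) (br x' y')"
      by (rule ratio_pow_mult_le) simp
    also have "\<dots> = dist_p 0 x x'"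
      using b(2) b'(2) by simp
    also have "\<dots> \<le> r"
      using dist_0_le_ext_dist[OF x(1) x'(1)] r by simp
    finally show ?thesis
      using ratio_pow_mult_le[of "dist_p m (br x y) (br x' y')" m] by simp
  next
    case False
    have "0 \<le> B"
      using B(2)[OF x(1) x(1), of 0] x(1) by simp
    have "(1 / c) ^ m * dist_p m (br x y) (br x' y') \<le> (1 / c) ^ m * B"
      using ratio_pow[of m] b(1) b'(1) by (intro mult_left_mono B(2)) auto
    also have "\<dots> \<le> (1 / c) ^ k * B"
      using False ratio \<open>0 \<le> B\<close> by (intro mult_right_mono power_decreasing) auto
    finally show ?thesis
      using B(1) by simp
  qed
qed

lemma br_continuous:
  "continuous_map (subtopology (prod_topology (mtopology_of dS) (mtopology_of dS))
     {(x, y). mdist dS x y \<le> \<epsilon> / 8}) (mtopology_of dS) (\<lambda>(x, y). br x y)"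
  (is "continuous_map ?X _ ?f")
proof -
  have "continuous_map ?X (Metric_space.mtopology (mspace dS) (mdist dS)) ?f"
    unfolding Metric_space.continuous_map_to_metric[OF Metric_space_mspace_mdist]
  proof (intro ballI allI impI)
    fix u and r :: real assume u: "u \<in> topspace ?X" and r: "0 < r"
    obtain x y where u_def: "u = (x, y)" by fastforce
    have xy: "x \<in> S" "y \<in> S" "ext_dist x y \<le> \<epsilon> / 8"
      using u by (auto simp: u_def)
    obtain B where B: "B > 0" "\<And>m x y. x \<in> S \<Longrightarrow> y \<in> S \<Longrightarrow> dist_p m x y \<le> B"
      using bounded_J_all by blast
    obtain k where k: "\<And>m. m \<ge> k \<Longrightarrow> (1 / c) ^ m * B < r / 2"
      using small_ratio[of "r / 2" B] r by auto
    define \<delta> where "\<delta> = \<epsilon> / 4 * (1 / c) ^ k"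
    have "0 < \<delta>"
      using e_pos ratio_pow[of k] by (auto simp: \<delta>_def)
    define U where "U = (mball_of dS x (r / 2) \<times> mball_of dS y \<delta>) \<inter> {(x, y). mdist dS x y \<le> \<epsilon> / 8}"
    have ball: "openin (mtopology_of dS) (mball_of dS z \<eta>)" for z \<eta>
      unfolding mtopology_of_def mball_of_def
      by (rule Metric_space.openin_mball[OF Metric_space_mspace_mdist])
    have "openin ?X U"
      unfolding U_def by (intro openin_subtopology_Int) (simp add: openin_prod_Times_iff ball)
    moreover have "u \<in> U"
      using xy r \<open>0 < \<delta>\<close> metric_dS
      by (simp add: U_def u_def mball_of_def Metric_space.in_mball[OF metric_dS] Metric_space.mdist_zero)
    moreover have "?f v \<in> Metric_space.mball (mspace dS) (mdist dS) (?f u) r" if "v \<in> U" for v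
    proof -
      obtain x' y' where v: "v = (x', y')" by fastforce
      have xy': "x' \<in> S" "y' \<in> S" "ext_dist x x' < r / 2" "ext_dist y y' < \<delta>"
        using that xy by (auto simp: U_def v mball_of_def Metric_space.in_mball[OF metric_dS])
      then have "ext_dist x' y' \<le> \<epsilon> / 8"
        using that by (auto simp: U_def v)
      then have "ext_dist (br x y) (br x' y') \<le> r / 2"
        using br_continuous_estimate[OF xy xy'(1,2), of k "r / 2" B] xy' k[of k] B
        by (simp add: \<delta>_def)
      then show ?thesis
        using r br_props(1)[OF xy] br_props(1)[OF xy'(1,2) \<open>ext_dist x' y' \<le> \<epsilon> / 8\<close>]
        by (simp add: u_def v Metric_space.in_mball[OF metric_dS])
    qed
    ultimately show "\<exists>U. openin ?X U \<and> u \<in> U \<and>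
        (\<forall>v\<in>U. ?f v \<in> Metric_space.mball (mspace dS) (mdist dS) (?f u) r)"
      by blast
  qed
  then show ?thesis
    by (simp only: mtopology_of_def)
qed

lemma smale_space_ext_dist: "smale_space dS \<phi> (\<epsilon> / 8) (1 / c) br"
proof
  show "compact_space (mtopology_of dS)" "homeomorphic_map (mtopology_of dS) (mtopology_of dS) \<phi>"
    using compact_T homeo by (simp_all add: mtopology_dS)
  show "0 < \<epsilon> / 8" "0 < 1 / c" "1 / c < 1"
    using e_pos ratio by auto
  show "continuous_map (subtopology (prod_topology (mtopology_of dS) (mtopology_of dS))
     {(x, y). mdist dS x y \<le> \<epsilon> / 8}) (mtopology_of dS) (\<lambda>(x, y). br x y)"
    by (rule br_continuous)
next
  fix x assume "x \<in> mspace dS"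
  then show "br x x = x"
    using e_pos by (intro br_unique) auto
next
  fix x y z
  assume "x \<in> mspace dS" "y \<in> mspace dS" "z \<in> mspace dS" "mdist dS y z \<le> \<epsilon> / 8"
    "mdist dS x (br y z) \<le> \<epsilon> / 8" "mdist dS x z \<le> \<epsilon> / 8"
  then have xyz: "x \<in> S" "y \<in> S" "z \<in> S" and yz: "ext_dist y z \<le> \<epsilon> / 8"
    and x_yz: "ext_dist x (br y z) \<le> \<epsilon> / 8" and xz: "ext_dist x z \<le> \<epsilon> / 8"
    using br_props(1)[of y z] by auto
  note b = br_props[OF xyz(2,3) yz]
  note b' = br_props[OF xyz(1) b(1) x_yz]
  \<comment> \<open>Two chained brackets deviate by at most
    \<open>\<epsilon> / 8 + \<epsilon> / 8\<close>, below the \<open>\<epsilon> / 2\<close> that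
    uniqueness requires.\<close>
  have "dist_p m (br x (br y z)) z < \<epsilon> / 2" for m
    using mdist_triangle[of "p m (br x (br y z))" J "p m (br y z)" "p m z"] b(1) b'(1) xyz
      b(4)[of m] b'(4)[of m] e_pos by simp
  then show "br x (br y z) = br x z"
    using br_unique[OF b'(1) xyz(3) b'(2)] by simp
next
  fix x y z
  assume "x \<in> mspace dS" "y \<in> mspace dS" "z \<in> mspace dS" "mdist dS x y \<le> \<epsilon> / 8"
    "mdist dS (br x y) z \<le> \<epsilon> / 8" "mdist dS x z \<le> \<epsilon> / 8"
  then have "p 0 (br x y) = p 0 x"
    by (intro br_props(2)) auto
  then show "br (br x y) z = br x z"
    by (simp add: br_def)
next
  fix x y
  assume "x \<in> mspace dS" "y \<in> mspace dS" "mdist dS x y \<le> \<epsilon> / 8"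
    "mdist dS (\<phi> x) (\<phi> y) \<le> \<epsilon> / 8"
  then have xy: "x \<in> S" "y \<in> S" "ext_dist x y \<le> \<epsilon> / 8" and phi: "ext_dist (\<phi> x) (\<phi> y) \<le> \<epsilon> / 8"
    by auto
  note b = br_props[OF xy]
  have "br (\<phi> x) (\<phi> y) = \<phi> (br x y)"
  proof (rule br_unique)
    show "p 0 (\<phi> (br x y)) = p 0 (\<phi> x)"
      using b xy by (simp add: p_0)
    show "dist_p m (\<phi> (br x y)) (\<phi> y) < \<epsilon> / 2" for m
    \<comment> \<open>Coordinate \<open>Suc k\<close> of the images is coordinate \<open>k\<close>
      of the originals, but coordinate 0 is new; it is controlled by the hypothesis that
      \<open>\<phi> x\<close> and \<open>\<phi> y\<close> are close themselves.\<close>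
    proof (cases m)
      case 0
      have "dist_p 0 (\<phi> (br x y)) (\<phi> y) = dist_p 0 (\<phi> x) (\<phi> y)"
        using b xy by (simp add: p_0)
      also have "\<dots> \<le> \<epsilon> / 8"
        using dist_0_le_ext_dist[of "\<phi> x" "\<phi> y"] xy phi by simp
      finally show ?thesis
        using 0 e_pos by simp
    next
      case (Suc k)
      then show ?thesis
        using b(1) b(4)[of k] xy e_pos by (simp add: p_Suc)
    qed
  qed (use b xy in auto)
  then show "\<phi> (br x y) = br (\<phi> x) (\<phi> y)" by simp
next
  fix x y
  assume "x \<in> mspace dS" "y \<in> mspace dS" "mdist dS x y \<le> \<epsilon> / 8" "br x y = y"
  then show "mdist dS (\<phi> x) (\<phi> y) \<le> 1 / c * mdist dS x y"
    using ext_dist_phi[of x y] br_eq_right_iff[of x y] by simp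
next
  fix x y
  assume "x \<in> mspace dS" "y \<in> mspace dS" "mdist dS x y \<le> \<epsilon> / 8" "br x y = x"
  then show "mdist dS (inv_into (mspace dS) \<phi> x) (inv_into (mspace dS) \<phi> y) \<le> 1 / c * mdist dS x y"
    using unstable_ext_dist[of x y] by (simp add: inv_phi)
qed

section \<open>Local stable sets and total disconnectedness\<close>

lemma local_stable_set_iff:
  assumes "y \<in> S" "\<delta> < \<epsilon> / 8"
  shows "z \<in> local_stable_set dS br y \<delta> \<longleftrightarrow> z \<in> S \<and> ext_dist y z < \<delta> \<and> p 0 z = p 0 y"
  using br_eq_right_iff[of z y] assms by (auto simp: local_stable_set_def ext_dist_commute)

text \<open>The iterates of \<open>y\<close> and \<open>z\<close> approach each other at the rate
  \<open>(1 / c) ^ n\<close>. Hence every point of a local stable set may serve as the centre of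
  another generator of the same stable topology.\<close>

lemma stable_class_if_p_0_eq:
  assumes y: "y \<in> stable_class dS \<phi> x" and z: "z \<in> S" "p 0 z = p 0 y" and x: "x \<in> S"
  shows "z \<in> stable_class dS \<phi> x"
proof -
  have yS: "y \<in> S" and lim: "(\<lambda>n. mdist dS ((\<phi> ^^ n) x) ((\<phi> ^^ n) y)) \<longlonglongrightarrow> 0"
    using y by (auto simp: stable_class_def)
  have in_S: "(\<phi> ^^ n) w \<in> S" if "w \<in> S" for n w
    using that by (induction n) auto
  have p0: "p 0 ((\<phi> ^^ n) z) = p 0 ((\<phi> ^^ n) y)" for n
    by (induction n) (auto simp: z in_S yS p_0)
  have le: "ext_dist ((\<phi> ^^ n) y) ((\<phi> ^^ n) z) \<le> (1 / c) ^ n * ext_dist y z" for n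
  proof (induction n)
    case (Suc n)
    have "ext_dist ((\<phi> ^^ Suc n) y) ((\<phi> ^^ Suc n) z) \<le> 1 / c * ext_dist ((\<phi> ^^ n) y) ((\<phi> ^^ n) z)"
      using ext_dist_phi[of "(\<phi> ^^ n) y" "(\<phi> ^^ n) z"] p0 in_S yS z by simp
    also have "\<dots> \<le> 1 / c * ((1 / c) ^ n * ext_dist y z)"
      using Suc ratio by (intro mult_left_mono) auto
    finally show ?case by simp
  qed simp
  have "(\<lambda>n. (1 / c) ^ n * ext_dist y z) \<longlonglongrightarrow> 0 * ext_dist y z"
    using ratio by (intro tendsto_mult_right LIMSEQ_power_zero) simp
  with lim have "(\<lambda>n. mdist dS ((\<phi> ^^ n) x) ((\<phi> ^^ n) y) + (1 / c) ^ n * ext_dist y z) \<longlonglongrightarrow> 0"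
    using tendsto_add by fastforce
  then have "(\<lambda>n. mdist dS ((\<phi> ^^ n) x) ((\<phi> ^^ n) z)) \<longlonglongrightarrow> 0"
  proof (rule Lim_null_comparison[rotated], intro always_eventually allI)
    fix n
    have "mdist dS ((\<phi> ^^ n) x) ((\<phi> ^^ n) z)
        \<le> mdist dS ((\<phi> ^^ n) x) ((\<phi> ^^ n) y) + mdist dS ((\<phi> ^^ n) y) ((\<phi> ^^ n) z)"
      using in_S x yS z by (intro mdist_triangle) auto
    then show "norm (mdist dS ((\<phi> ^^ n) x) ((\<phi> ^^ n) z))
        \<le> mdist dS ((\<phi> ^^ n) x) ((\<phi> ^^ n) y) + (1 / c) ^ n * ext_dist y z"
      using le[of n] in_S yS z by simp
  qed
  then show ?thesis
    using z by (simp add: stable_class_def)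
qed

text \<open>The local stable sets are the sets on which the zeroth coordinate is constant; since \<open>s\<close>
  multiplies small distances by \<open>c\<close>, sufficiently close points of such a set also agree in the
  \<open>m\<close>-th coordinate.\<close>

lemma p_locally_constant:
  assumes x: "x \<in> S"
  shows "openin (stable_topology dS \<phi> (\<epsilon> / 8) br x)
    {z \<in> topspace (stable_topology dS \<phi> (\<epsilon> / 8) br x). p m z \<in> A}"
proof (subst openin_subopen, intro ballI)
  let ?T = "stable_topology dS \<phi> (\<epsilon> / 8) br x"
  fix y assume "y \<in> {z \<in> topspace ?T. p m z \<in> A}"
  then have y: "y \<in> topspace ?T" "p m y \<in> A" by auto
  from y(1) obtain w \<delta>' where w: "w \<in> stable_class dS \<phi> x" "0 < \<delta>'" "\<delta>' < \<epsilon> / 8"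
    "y \<in> local_stable_set dS br w \<delta>'"
    unfolding stable_topology_def topology_generated_by_topspace by auto
  then have wS: "w \<in> S"
    by (auto simp: stable_class_def)
  then have yS: "y \<in> S" and "p 0 y = p 0 w"
    using w local_stable_set_iff[of w \<delta>' y] by auto
  then have y_stable: "y \<in> stable_class dS \<phi> x"
    using stable_class_if_p_0_eq w x by blast
  \<comment> \<open>Chosen so that \<open>c ^ m * \<delta> = \<epsilon> / 16\<close>: all
    coordinates up to \<open>m\<close> stay within \<open>\<epsilon>\<close>, and
    \<open>\<delta>\<close> is strictly below \<open>\<epsilon> / 8\<close> even for
    \<open>m = 0\<close>.\<close>
  define \<delta> where "\<delta> = (1 / c) ^ m * \<epsilon> / 16"
  have \<delta>: "0 < \<delta>" "\<delta> < \<epsilon> / 8"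
    using ratio_pow[of m] ratio_pow_mult_le[of \<epsilon> m] e_pos by (auto simp: \<delta>_def)
  let ?U = "local_stable_set dS br y \<delta>"
  have U: "openin ?T ?U"
    unfolding stable_topology_def using y_stable \<delta> by (intro topology_generated_by_Basis) auto
  have "p m z \<in> A" if "z \<in> ?U" for z
  proof -
    have z: "z \<in> S" "ext_dist y z < \<delta>" "p 0 z = p 0 y"
      using that local_stable_set_iff[OF yS \<delta>(2)] by auto
    have "dist_p i y z < \<epsilon>" if "i \<le> m" for i
    proof -
      have "dist_p i y z \<le> c ^ i * ext_dist y z"
        by (intro dist_le_ext_dist yS z)
      also have "\<dots> \<le> c ^ m * ext_dist y z"
        using that c_gt_1 mdist_nonneg[of dS y z] yS z
        by (intro mult_right_mono power_increasing) auto
      also have "\<dots> \<le> c ^ m * \<delta>"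
        using z ratio by (intro mult_left_mono) auto
      also have "\<dots> = \<epsilon> / 16"
        using ratio by (simp add: \<delta>_def power_divide)
      finally show ?thesis
        using e_pos by simp
    qed
    then have "dist_p m y z = 0"
      using close_coordinates[of y z m] yS z by simp
    then have "p m y = p m z"
      using yS z by simp
    then show ?thesis
      using y(2) by simp
  qed
  moreover have "y \<in> ?U"
    using local_stable_set_iff[OF yS \<delta>(2)] yS \<delta> mdist_zero[of y dS y] by simp
  ultimately have "y \<in> ?U \<and> ?U \<subseteq> {z \<in> topspace ?T. p m z \<in> A}"
    using openin_subset[OF U] by blast
  with U show "\<exists>U. openin ?T U \<and> y \<in> U \<and> U \<subseteq> {z \<in> topspace ?T. p m z \<in> A}"
    by blast
qed

text \<open>As \<open>p_locally_constant\<close> holds for every \<open>A\<close>, the level sets of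
  \<open>p m\<close> are clopen. A connected set lies in one level set for each \<open>m\<close>,
  and the coordinates separate points.\<close>

lemma totally_disconnected_stable_sets_ext_dist: "totally_disconnected_stable_sets dS \<phi> (\<epsilon> / 8) br"
  unfolding totally_disconnected_stable_sets_def totally_disconnected_space_def
proof (intro ballI allI impI)
  fix x C
  let ?T = "stable_topology dS \<phi> (\<epsilon> / 8) br x"
  assume "x \<in> mspace dS" and C: "connectedin ?T C"
  then have x: "x \<in> S" by simp
  have sub: "topspace ?T \<subseteq> S"
    by (auto simp: stable_topology_def topology_generated_by_topspace local_stable_set_def)
  have "y = z" if yz: "y \<in> C" "z \<in> C" for y z
  proof (rule p_inj)
    have top: "C \<subseteq> topspace ?T"
      using C connectedin_subset_topspace by blast
    then show "y \<in> S" "z \<in> S"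
      using sub yz by auto
    fix m
    let ?U = "{w \<in> topspace ?T. p m w \<in> {p m y}}" and ?V = "{w \<in> topspace ?T. p m w \<in> - {p m y}}"
    have "C \<subseteq> ?U \<union> ?V" "?U \<inter> ?V \<inter> C = {}" "?U \<inter> C \<noteq> {}"
      using top yz by auto
    then have "?V \<inter> C = {}"
      using connectedinD[OF C p_locally_constant[OF x, of m] p_locally_constant[OF x, of m],
        of "{p m y}" "- {p m y}"] by blast
    then show "p m y = p m z"
      using top yz by auto
  qed
  then show "\<exists>a. C \<subseteq> {a}"
    by blast
qed

end

section \<open>Spaces of infinite paths\<close>

lemma topspace_left_inf_topology [simp]: "topspace (left_inf_topology E) = left_inf_paths E"
proof -
  have "x \<in> \<Union>{{x \<in> left_inf_paths E. \<forall>k<n. x k = z k} | z n. z \<in> left_inf_paths E}"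
    if "x \<in> left_inf_paths E" for x
    using that by (intro UnionI[of "{y \<in> left_inf_paths E. \<forall>k<0. y k = x k}"]) blast+
  then show ?thesis
    unfolding left_inf_topology_def topology_generated_by_topspace by blast
qed

lemma topspace_bi_inf_topology [simp]: "topspace (bi_inf_topology E) = bi_inf_paths E"
proof -
  have "x \<in> \<Union>{{x \<in> bi_inf_paths E. \<forall>k\<in>{m..n}. x k = z k} | z m n. z \<in> bi_inf_paths E}"
    if "x \<in> bi_inf_paths E" for x
    using that by (intro UnionI[of "{y \<in> bi_inf_paths E. \<forall>k\<in>{0..0}. y k = x k}"]) blast+
  then show ?thesis
    unfolding bi_inf_topology_def topology_generated_by_topspace by blast
qed

text \<open>Here \<open>z\<close> need not be a path, which allows reindexed sequences: a non-empty
  cylinder can be centred at any of its members.\<close>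

lemma openin_bi_inf_cylinder:
  "openin (bi_inf_topology E) {x \<in> bi_inf_paths E. \<forall>k\<in>{m..n}. x k = z k}"
proof (cases "{x \<in> bi_inf_paths E. \<forall>k\<in>{m..n}. x k = z k} = {}")
  case False
  then obtain w where w: "w \<in> bi_inf_paths E" "\<forall>k\<in>{m..n}. w k = z k" by blast
  then have "{x \<in> bi_inf_paths E. \<forall>k\<in>{m..n}. x k = z k} = {x \<in> bi_inf_paths E. \<forall>k\<in>{m..n}. x k = w k}"
    by auto
  then show ?thesis
    unfolding bi_inf_topology_def using w(1) by (intro topology_generated_by_Basis) auto
qed (simp only: openin_empty)

text \<open>Symmetric windows are nested, which settles finite intersections, and every window lies
  in one of them. So their cylinders form a neighbourhood base.\<close>

lemma openin_bi_inf_contains_cylinder: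
  assumes "openin (bi_inf_topology E) U" "z \<in> U"
  shows "\<exists>n::nat. {x \<in> bi_inf_paths E. \<forall>k\<in>{- int n..int n}. x k = z k} \<subseteq> U"
proof -
  have "generate_topology_on {{x \<in> bi_inf_paths E. \<forall>k\<in>{m..n}. x k = z k} | z m n. z \<in> bi_inf_paths E} U"
    using assms(1) unfolding bi_inf_topology_def by (rule openin_topology_generated_by)
  then show ?thesis
    using assms(2)
  proof (induction arbitrary: z)
    case (Int a b)
    obtain n1 where n1: "{x \<in> bi_inf_paths E. \<forall>k\<in>{- int n1..int n1}. x k = z k} \<subseteq> a"
      using Int.IH(1)[OF IntD1[OF Int.prems]] by (rule exE)
    obtain n2 where n2: "{x \<in> bi_inf_paths E. \<forall>k\<in>{- int n2..int n2}. x k = z k} \<subseteq> b"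
      using Int.IH(2)[OF IntD2[OF Int.prems]] by (rule exE)
    have "{x \<in> bi_inf_paths E. \<forall>k\<in>{- int (n1 + n2)..int (n1 + n2)}. x k = z k}
      \<subseteq> {x \<in> bi_inf_paths E. \<forall>k\<in>{- int n1..int n1}. x k = z k} \<inter>
        {x \<in> bi_inf_paths E. \<forall>k\<in>{- int n2..int n2}. x k = z k}"
      by auto
    then have "{x \<in> bi_inf_paths E. \<forall>k\<in>{- int (n1 + n2)..int (n1 + n2)}. x k = z k} \<subseteq> a \<inter> b"
      by (rule order_trans[OF _ Int_mono[OF n1 n2]])
    then show ?case by (rule exI)
  next
    case (UN K)
    then obtain k where "k \<in> K" "z \<in> k" by blast
    with UN.IH[OF this] show ?case by blast
  next
    case (Basis s)
    then obtain w m n where s: "s = {x \<in> bi_inf_paths E. \<forall>k\<in>{m..n}. x k = w k}" by auto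
    have "{m..n} \<subseteq> {- int (nat (\<bar>m\<bar> + \<bar>n\<bar>))..int (nat (\<bar>m\<bar> + \<bar>n\<bar>))}" by auto
    then have "{x \<in> bi_inf_paths E. \<forall>k\<in>{- int (nat (\<bar>m\<bar> + \<bar>n\<bar>))..int (nat (\<bar>m\<bar> + \<bar>n\<bar>))}. x k = z k} \<subseteq> s"
      using Basis(2) unfolding s by fastforce
    then show ?case by (rule exI)
  qed simp
qed

text \<open>By Tychonoff's theorem for finite discrete factors: the paths form a closed subset of
  the product, and the cylinder topology is no finer than the subspace topology.\<close>

lemma compact_space_bi_inf_topology:
  assumes "finite (arcs E)"
  shows "compact_space (bi_inf_topology E)"
proof -
  let ?P = "product_topology (\<lambda>_::int. discrete_topology (arcs E)) UNIV"
  have compact: "compact_space ?P"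
    using assms by (simp add: compact_space_product_topology compact_space_discrete_topology)
  have topP: "topspace ?P = {x. \<forall>n. x n \<in> arcs E}"
    by auto
  have coord: "openin ?P {x \<in> topspace ?P. x n \<in> A}" if "A \<subseteq> arcs E" for n A
    using openin_continuous_map_preimage[OF continuous_map_product_projection[of n UNIV "\<lambda>_. discrete_topology (arcs E)"], of A]
      that by simp
  \<comment> \<open>A sequence of edges fails to be a path exactly when two neighbouring edges do
    not match, an open condition.\<close>
  let ?bad = "\<lambda>n a b. {x \<in> topspace ?P. x n \<in> {a}} \<inter> {x \<in> topspace ?P. x (n + 1) \<in> {b}}"
  have bad: "openin ?P (?bad n a b)" if "a \<in> arcs E" "b \<in> arcs E" for n a b
    using that by (intro openin_Int coord) auto
  have "topspace ?P - bi_inf_paths E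
      = (\<Union>n. \<Union>(a, b)\<in>{(a, b) \<in> arcs E \<times> arcs E. tail E a \<noteq> head E b}. ?bad n a b)"
    unfolding topP bi_inf_paths_def by auto
  moreover have "openin ?P \<dots>"
    by (rule openin_Union, clarify, rule openin_Union, clarify, rule bad)
  ultimately have "closedin ?P (bi_inf_paths E)"
    unfolding closedin_def topP by (auto simp: bi_inf_paths_def)
  then have "compactin ?P (bi_inf_paths E)"
    using compact closedin_compact_space by blast
  then have comp: "compactin (subtopology ?P (bi_inf_paths E)) (bi_inf_paths E)"
    by (simp add: compactin_subtopology)
  have "continuous_map (subtopology ?P (bi_inf_paths E)) (bi_inf_topology E) id"
    unfolding bi_inf_topology_def
  proof (rule continuous_on_generated_topo)
    fix U assume "U \<in> {{x \<in> bi_inf_paths E. \<forall>k\<in>{m..n}. x k = z k} | z m n. z \<in> bi_inf_paths E}"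
    then obtain z m n where U: "U = {x \<in> bi_inf_paths E. \<forall>k\<in>{m..n}. x k = z k}"
      and z: "z \<in> bi_inf_paths E" by auto
    have "openin ?P ((\<Inter>k\<in>{m..n}. {x \<in> topspace ?P. x k \<in> {z k}}) \<inter> topspace ?P)"
      by (intro openin_INT coord) (use z in \<open>auto simp: bi_inf_paths_def\<close>)
    then have "openin (subtopology ?P (bi_inf_paths E))
        (((\<Inter>k\<in>{m..n}. {x \<in> topspace ?P. x k \<in> {z k}}) \<inter> topspace ?P) \<inter> bi_inf_paths E)"
      unfolding openin_subtopology by blast
    also have "((\<Inter>k\<in>{m..n}. {x \<in> topspace ?P. x k \<in> {z k}}) \<inter> topspace ?P) \<inter> bi_inf_paths E
        = id -` U \<inter> topspace (subtopology ?P (bi_inf_paths E))"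
      unfolding topspace_subtopology topP U by (auto simp: bi_inf_paths_def)
    finally show "openin (subtopology ?P (bi_inf_paths E))
      (id -` U \<inter> topspace (subtopology ?P (bi_inf_paths E)))" .
  next
    show "id ` topspace (subtopology ?P (bi_inf_paths E))
      \<subseteq> \<Union>{{x \<in> bi_inf_paths E. \<forall>k\<in>{m..n}. x k = z k} | z m n. z \<in> bi_inf_paths E}"
      using topspace_bi_inf_topology[of E]
      unfolding bi_inf_topology_def topology_generated_by_topspace by auto
  qed
  from image_compactin[OF comp this] show ?thesis
    by (simp add: compact_space_def)
qed

lemma left_half_in: "x \<in> bi_inf_paths E \<Longrightarrow> left_half x m \<in> left_inf_paths E"
  unfolding bi_inf_paths_def left_inf_paths_def left_half_def
  by auto

lemma left_shift_left_half: "left_shift (left_half x m) = left_half x (m - 1)"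
  by (auto simp: left_shift_def left_half_def algebra_simps)

lemma left_half_bi_shift: "left_half (bi_shift x) m = left_half x (m - 1)"
  by (auto simp: bi_shift_def left_half_def algebra_simps)

lemma bi_translate_in: "x \<in> bi_inf_paths E \<Longrightarrow> (\<lambda>n. x (n + i)) \<in> bi_inf_paths E"
  unfolding bi_inf_paths_def by (auto simp: add.assoc) (metis add.assoc add.commute)

lemma continuous_left_half:
  "continuous_map (bi_inf_topology E) (left_inf_topology E) (\<lambda>x. left_half x m)"
  unfolding left_inf_topology_def
proof (rule continuous_on_generated_topo)
  fix U assume "U \<in> {{x \<in> left_inf_paths E. \<forall>k<n. x k = z k} | z n. z \<in> left_inf_paths E}"
  then obtain z n where U: "U = {x \<in> left_inf_paths E. \<forall>k<n. x k = z k}" by auto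
  \<comment> \<open>Left-infinite paths are read from right to left, so the first \<open>n\<close>
    entries are the window from \<open>m - n + 1\<close> to \<open>m\<close> in reverse.\<close>
  have "(\<forall>k<n. x (m - int k) = z k) \<longleftrightarrow> (\<forall>k\<in>{m - int n + 1..m}. x k = z (nat (m - k)))" for x
  proof (intro iffI ballI allI impI)
    fix k assume h: "\<forall>k<n. x (m - int k) = z k" and k: "k \<in> {m - int n + 1..m}"
    have "nat (m - k) < n" using k by auto
    with h have "x (m - int (nat (m - k))) = z (nat (m - k))" by blast
    then show "x k = z (nat (m - k))" using k by simp
  next
    fix k assume h: "\<forall>k\<in>{m - int n + 1..m}. x k = z (nat (m - k))" and "k < n"
    then show "x (m - int k) = z k" using bspec[OF h, of "m - int k"] by simp
  qed
  then have "(\<lambda>x. left_half x m) -` U \<inter> topspace (bi_inf_topology E)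
      = {x \<in> bi_inf_paths E. \<forall>k\<in>{m - int n + 1..m}. x k = z (nat (m - k))}"
    unfolding U by (auto simp: left_half_in) (auto simp: left_half_def)
  then show "openin (bi_inf_topology E) ((\<lambda>x. left_half x m) -` U \<inter> topspace (bi_inf_topology E))"
    by (simp only: openin_bi_inf_cylinder)
next
  show "(\<lambda>x. left_half x m) ` topspace (bi_inf_topology E)
      \<subseteq> \<Union>{{x \<in> left_inf_paths E. \<forall>k<n. x k = z k} | z n. z \<in> left_inf_paths E}"
    using topspace_left_inf_topology[of E] left_half_in[of _ E m]
    unfolding left_inf_topology_def topology_generated_by_topspace by auto
qed

lemma continuous_bi_translate:
  "continuous_map (bi_inf_topology E) (bi_inf_topology E) (\<lambda>x n. x (n + i))"
proof -
  have "continuous_map (bi_inf_topology E)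
      (topology_generated_by {{x \<in> bi_inf_paths E. \<forall>k\<in>{m..n}. x k = z k} | z m n. z \<in> bi_inf_paths E})
      (\<lambda>x n. x (n + i))"
  proof (rule continuous_on_generated_topo)
    fix U assume "U \<in> {{x \<in> bi_inf_paths E. \<forall>k\<in>{m..n}. x k = z k} | z m n. z \<in> bi_inf_paths E}"
    then obtain z m n where U: "U = {x \<in> bi_inf_paths E. \<forall>k\<in>{m..n}. x k = z k}" by auto
    have "(\<forall>k\<in>{m..n}. x (k + i) = z k) \<longleftrightarrow> (\<forall>k\<in>{m + i..n + i}. x k = z (k - i))" for x
    proof (intro iffI ballI)
      fix k assume h: "\<forall>k\<in>{m..n}. x (k + i) = z k" and "k \<in> {m + i..n + i}"
      then show "x k = z (k - i)" using bspec[OF h, of "k - i"] by simp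
    next
      fix k assume h: "\<forall>k\<in>{m + i..n + i}. x k = z (k - i)" and "k \<in> {m..n}"
      then show "x (k + i) = z k" using bspec[OF h, of "k + i"] by simp
    qed
    then have "(\<lambda>x n. x (n + i)) -` U \<inter> topspace (bi_inf_topology E)
        = {x \<in> bi_inf_paths E. \<forall>k\<in>{m + i..n + i}. x k = z (k - i)}"
      unfolding U by (auto simp: bi_translate_in)
    then show "openin (bi_inf_topology E) ((\<lambda>x n. x (n + i)) -` U \<inter> topspace (bi_inf_topology E))"
      by (simp only: openin_bi_inf_cylinder)
  next
    show "(\<lambda>x n. x (n + i)) ` topspace (bi_inf_topology E)
        \<subseteq> \<Union>{{x \<in> bi_inf_paths E. \<forall>k\<in>{m..n}. x k = z k} | z m n. z \<in> bi_inf_paths E}"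
      using topspace_bi_inf_topology[of E] bi_translate_in[of _ E i]
      unfolding bi_inf_topology_def topology_generated_by_topspace by auto
  qed
  then show ?thesis
    by (simp only: bi_inf_topology_def)
qed

section \<open>Extending and joining paths\<close>

lemma (in wf_digraph) ex_bi_inf_extension:
  assumes ns: "no_sources G" and x: "x \<in> left_inf_paths G"
  shows "\<exists>y\<in>bi_inf_paths G. left_half y m = x"
proof -
  \<comment> \<open>To the right of an edge \<open>e\<close> there must come an edge whose range is
    the source of \<open>e\<close>; absence of sources provides it. Starting at \<open>x 0\<close>,
    the new part overlaps \<open>x\<close> in position \<open>m\<close>.\<close>
  have "\<exists>f::nat \<Rightarrow> 'b. \<forall>k. (f k \<in> arcs G \<and> (k = 0 \<longrightarrow> f k = x 0)) \<and> head G (f (Suc k)) = tail G (f k)"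
  proof (rule dependent_nat_choice)
    show "\<exists>e. e \<in> arcs G \<and> ((0::nat) = 0 \<longrightarrow> e = x 0)"
      using x by (auto simp: left_inf_paths_def)
  next
    fix e and k :: nat assume "e \<in> arcs G \<and> (k = 0 \<longrightarrow> e = x 0)"
    then have "in_arcs G (tail G e) \<noteq> {}"
      using ns by (auto simp: no_sources_def)
    then show "\<exists>e'. (e' \<in> arcs G \<and> (Suc k = 0 \<longrightarrow> e' = x 0)) \<and> head G e' = tail G e"
      by auto
  qed
  then obtain f where f: "\<And>k. f k \<in> arcs G" "f 0 = x 0" "\<And>k. head G (f (Suc k)) = tail G (f k)"
    by metis
  define y where "y j = (if j \<le> m then x (nat (m - j)) else f (nat (j - m)))" for j
  have "tail G (y j) = head G (y (j + 1))" for j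
  proof -
    consider "j < m" | "j = m" | "j > m" by linarith
    then show ?thesis
    proof cases
      case 1
      then have "nat (m - j) = Suc (nat (m - (j + 1)))" by simp
      then show ?thesis using 1 x by (simp add: y_def left_inf_paths_def)
    next
      case 2
      then show ?thesis using f(2) f(3)[of 0] by (simp add: y_def)
    next
      case 3
      then have "nat (j + 1 - m) = Suc (nat (j - m))" by simp
      then show ?thesis using 3 f(3) by (simp add: y_def)
    qed
  qed
  then have "y \<in> bi_inf_paths G"
    using x f(1) by (auto simp: bi_inf_paths_def y_def left_inf_paths_def)
  moreover have "left_half y m = x"
    by (auto simp: left_half_def y_def)
  ultimately show ?thesis by blast
qed

lemma (in wf_digraph) left_inf_append_path:
  assumes "is_path G v \<mu> u" "w \<in> left_inf_paths G" "tail G (w 0) = v"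
  shows "\<exists>w'\<in>left_inf_paths G. tail G (w' 0) = u \<and> (\<forall>k. w' (k + length \<mu>) = w k)"
  using assms
proof (induction \<mu> arbitrary: v w)
  case Nil
  then show ?case by (auto simp: is_path_Nil)
next
  case (Cons e \<mu>)
  then have e: "e \<in> arcs G" "head G e = v" "is_path G (tail G e) \<mu> u"
    by (auto simp: is_path_Cons)
  \<comment> \<open>Index 0 is the right end of a left-infinite path, so \<open>case_nat\<close>
    appends \<open>e\<close> on the right and displaces \<open>w\<close> by one.\<close>
  define w1 where "w1 = case_nat e w"
  have "w1 \<in> left_inf_paths G"
    using Cons.prems e by (auto simp: left_inf_paths_def w1_def split: nat.split)
  moreover have "tail G (w1 0) = tail G e" by (simp add: w1_def)
  ultimately obtain w' where w': "w' \<in> left_inf_paths G" "tail G (w' 0) = u"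
    "\<And>k. w' (k + length \<mu>) = w1 k"
    using Cons.IH[OF e(3)] by blast
  have "w' (k + length (e # \<mu>)) = w k" for k
    using w'(3)[of "Suc k"] by (simp add: w1_def)
  with w' show ?case by blast
qed

text \<open>From left to right, \<open>x\<close> consists of \<open>w\<close> up to
  \<open>w n\<close>, then \<open>\<mu>\<close>, then \<open>z\<close> from \<open>z (- n)\<close>
  on. Since \<open>\<mu>\<close> ends at position \<open>- n - 1\<close>, the edge
  \<open>w n\<close> moves from \<open>n\<close> to \<open>- n - 1 - length \<mu>\<close>; this is
  the displacement in the statement.\<close>

lemma (in wf_digraph) ex_glued_path:
  assumes z: "z \<in> bi_inf_paths G" and w: "w \<in> bi_inf_paths G"
    and \<mu>: "is_path G (tail G (w n)) \<mu> (head G (z (- n)))" and n: "0 \<le> n"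
  shows "\<exists>x\<in>bi_inf_paths G. (\<forall>k\<ge>- n. x k = z k) \<and>
    (\<forall>k\<le>n. x (k - (2 * n + 1 + int (length \<mu>))) = w k)"
proof -
  obtain w' where w': "w' \<in> left_inf_paths G" "tail G (w' 0) = head G (z (- n))"
    "\<And>k. w' (k + length \<mu>) = left_half w n k"
    using left_inf_append_path[OF \<mu> left_half_in[OF w, of n]] by (auto simp: left_half_def)
  define x where "x j = (if j \<ge> - n then z j else w' (nat (- n - 1 - j)))" for j
  have "tail G (x j) = head G (x (j + 1))" for j
  proof -
    consider "j < - n - 1" | "j = - n - 1" | "j \<ge> - n" by linarith
    then show ?thesis
    proof cases
      case 1
      then have "nat (- n - 1 - j) = Suc (nat (- n - 1 - (j + 1)))" by simp
      then show ?thesis using 1 w'(1) by (simp add: x_def left_inf_paths_def)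
    next
      case 2
      then show ?thesis using w'(2) by (simp add: x_def)
    next
      case 3
      then show ?thesis using z by (simp add: x_def bi_inf_paths_def)
    qed
  qed
  then have "x \<in> bi_inf_paths G"
    using z w'(1) by (auto simp: bi_inf_paths_def x_def left_inf_paths_def)
  moreover have "x (k - (2 * n + 1 + int (length \<mu>))) = w k" if "k \<le> n" for k
  proof -
    have "nat (- n - 1 - (k - (2 * n + 1 + int (length \<mu>)))) = nat (n - k) + length \<mu>"
      using that n by simp
    then show ?thesis
      using that n w'(3)[of "nat (n - k)"] by (simp add: x_def left_half_def)
  qed
  moreover have "x k = z k" if "k \<ge> - n" for k
    using that by (simp add: x_def)
  ultimately show ?thesis by blast
qed

text \<open>Absence of sources gives an edge with range \<open>v\<close> to put in front; the
  induction continues at its source, with \<open>w\<close> fixed.\<close>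

lemma (in wf_digraph) paths_of_larger_length:
  assumes ns: "no_sources G" and n: "\<forall>v\<in>verts G. \<forall>w\<in>verts G. \<exists>\<mu>. length \<mu> = n \<and> is_path G v \<mu> w"
    and "v \<in> verts G" "w \<in> verts G"
  shows "\<exists>\<mu>. length \<mu> = n + k \<and> is_path G v \<mu> w"
  using assms(3)
proof (induction k arbitrary: v)
  case 0
  then show ?case using n assms(4) by simp
next
  case (Suc k)
  then obtain e where e: "e \<in> arcs G" "head G e = v"
    using ns unfolding no_sources_def in_arcs_def by blast
  then obtain \<mu> where "length \<mu> = n + k" "is_path G (tail G e) \<mu> w"
    using Suc.IH[of "tail G e"] by auto
  then have "length (e # \<mu>) = n + Suc k \<and> is_path G v (e # \<mu>) w"
    using e by (simp add: is_path_Cons)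
  then show ?case by blast
qed

section \<open>Contraction and asymptotic equivalence\<close>

lemma left_segment_Suc: "left_segment x (Suc k) = x k # left_segment x k"
  by (simp add: left_segment_def)

lemma length_left_segment [simp]: "length (left_segment x k) = k"
  by (simp add: left_segment_def)

lemma left_segment_0 [simp]: "left_segment x 0 = []"
  by (simp add: left_segment_def)

lemma left_segment_add:
  "left_segment x (n + k) = left_segment (\<lambda>i. x (i + k)) n @ left_segment x k"
  by (induction n) (auto simp: left_segment_Suc)

lemma left_segment_left_shift:
  "left_segment x (Suc k) = left_segment (left_shift x) k @ [x 0]"
  using left_segment_add[of x k 1] by (simp add: left_shift_def left_segment_Suc)

text \<open>Left halves are indexed leftwards and right halves rightwards; both sides spell the word
  from \<open>x (m - k)\<close> to \<open>x m\<close>. The one-sided and the two-sided equivalence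
  are compared through this identity.\<close>

lemma left_segment_left_half:
  "left_segment (left_half x m) (Suc k) = map (right_half x (m - int k)) [0..<Suc k]"
  by (rule nth_equalityI)
    (auto simp: left_segment_def rev_nth left_half_def right_half_def nth_append of_nat_diff algebra_simps
      simp del: upt_Suc intro!: arg_cong[of _ _ x])

lemma upt_split: "i \<le> j \<Longrightarrow> [0..<j] = [0..<i] @ [i..<j]"
  using upt_add_eq_append[of 0 i "j - i"] by simp

context self_similar_action
begin

section \<open>Restrictions of arrows along paths and the nucleus\<close>

lemma Nil_in_paths_to [simp]: "[] \<in> paths_to E v \<longleftrightarrow> v \<in> verts E"
  by (auto simp: paths_to_def is_path_Nil)

lemma Cons_in_paths_to [simp]:
  "e # \<mu> \<in> paths_to E v \<longleftrightarrow> e \<in> arcs E \<and> head E e = v \<and> \<mu> \<in> paths_to E (tail E e)"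
  by (auto simp: paths_to_def is_path_Cons)

lemma path_source_Nil [simp]: "path_source E v [] = v"
  by (simp add: path_source_def)

lemma path_source_Cons [simp]: "path_source E v (e # \<mu>) = path_source E (tail E e) \<mu>"
  by (simp add: path_source_def)

lemma paths_to_append:
  "\<mu> @ \<nu> \<in> paths_to E v \<longleftrightarrow> \<mu> \<in> paths_to E v \<and> \<nu> \<in> paths_to E (path_source E v \<mu>)"
proof (induction \<mu> arbitrary: v)
  case Nil
  have "\<nu> \<in> paths_to E v \<Longrightarrow> v \<in> verts E"
    by (cases \<nu>) auto
  then show ?case by auto
qed auto

lemma set_paths_to: "\<mu> \<in> paths_to E v \<Longrightarrow> set \<mu> \<subseteq> arcs E"
  by (induction \<mu> arbitrary: v) auto

lemma act_in:
  assumes "g \<in> garrows G" "\<mu> \<in> paths_to E (gdom G g)"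
  shows "act g \<mu> \<in> paths_to E (gcod G g)" "length (act g \<mu>) = length \<mu>"
  using act_piso[OF assms(1)] assms(2) unfolding partial_isomorphism_def bij_betw_def by auto

lemma take_act:
  assumes g: "g \<in> garrows G" and "\<mu> @ \<nu> \<in> paths_to E (gdom G g)"
  shows "take (length \<mu>) (act g (\<mu> @ \<nu>)) = act g \<mu>"
  using assms(2)
proof (induction \<nu> rule: rev_induct)
  case Nil
  then show ?case using act_in[OF g] by simp
next
  case (snoc e \<nu>)
  have in1: "(\<mu> @ \<nu>) @ [e] \<in> paths_to E (gdom G g)"
    using snoc.prems by simp
  then have in2: "\<mu> @ \<nu> \<in> paths_to E (gdom G g)"
    using paths_to_append by blast
  obtain e' where "act g ((\<mu> @ \<nu>) @ [e]) = act g (\<mu> @ \<nu>) @ [e']"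
    using act_piso[OF g] in1 unfolding partial_isomorphism_def by blast
  then show ?case
    using snoc.IH[OF in2] act_in(2)[OF g in2] by simp
qed

text \<open>Two candidates act alike on all paths, because \<open>act g [e]\<close> can be
  cancelled, so \<open>act_inj\<close> identifies them and the definite description is
  proper.\<close>

lemma edge_restr:
  assumes g: "g \<in> garrows G" and e: "e \<in> arcs E" "head E e = gdom G g"
  shows "is_restriction E G act g e (edge_restr E G act g e)"
proof -
  obtain h where h: "is_restriction E G act g e h"
    using restriction_exists[OF g, of e] e by auto
  have "h' = h" if h': "is_restriction E G act g e h'" for h'
    using h h' unfolding is_restriction_def by (intro act_inj) auto
  with h show ?thesis
    unfolding edge_restr_def by (rule theI)
qed

lemma path_restr:
  assumes "g \<in> garrows G" "\<mu> \<in> paths_to E (gdom G g)"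
  shows "path_restr E G act g \<mu> \<in> garrows G \<and>
    gdom G (path_restr E G act g \<mu>) = path_source E (gdom G g) \<mu> \<and>
    (\<forall>\<nu>\<in>paths_to E (path_source E (gdom G g) \<mu>).
      act g (\<mu> @ \<nu>) = act g \<mu> @ act (path_restr E G act g \<mu>) \<nu>)"
  using assms
proof (induction \<mu> arbitrary: g)
  case Nil
  then show ?case using act_in(2)[of g "[]"] by simp
next
  case (Cons e \<mu>)
  let ?h = "edge_restr E G act g e"
  have e: "e \<in> arcs E" "head E e = gdom G g" and \<mu>: "\<mu> \<in> paths_to E (tail E e)"
    using Cons.prems by auto
  have h: "?h \<in> garrows G" "gdom G ?h = tail E e"
    "\<And>\<mu>. \<mu> \<in> paths_to E (tail E e) \<Longrightarrow> act g (e # \<mu>) = act g [e] @ act ?h \<mu>"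
    using edge_restr[OF Cons.prems(1) e] unfolding is_restriction_def by auto
  note IH = Cons.IH[OF h(1), unfolded h(2), OF \<mu>]
  have "act g (e # \<mu> @ \<nu>) = act g (e # \<mu>) @ act (path_restr E G act ?h \<mu>) \<nu>"
    if "\<nu> \<in> paths_to E (path_source E (tail E e) \<mu>)" for \<nu>
    using IH that h(3)[of "\<mu> @ \<nu>"] h(3)[OF \<mu>] \<mu> by (simp add: paths_to_append)
  then show ?case
    using IH by simp
qed

lemma path_restr_append:
  "path_restr E G act g (\<mu> @ \<nu>) = path_restr E G act (path_restr E G act g \<mu>) \<nu>"
  by (induction \<mu> arbitrary: g) auto

text \<open>\<open>contracting\<close> promises \<open>F\<close> at one level per arrow, and deeper
  restrictions might leave \<open>F\<close> again. But a path along which an arrow of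
  \<open>F\<close> is restricted splits into blocks of at most \<open>K\<close> edges, each of which
  leads back to \<open>F\<close>, and a remainder of at most \<open>K\<close> edges. So finitely
  many arrows absorb everything.\<close>

lemma finite_nucleus:
  assumes fin: "finite (arcs E)" and "contracting E G act"
  obtains N where "finite N" "N \<subseteq> garrows G"
    "\<And>g. g \<in> garrows G \<Longrightarrow> \<exists>n. \<forall>\<mu>\<in>paths_to E (gdom G g). n \<le> length \<mu> \<longrightarrow> path_restr E G act g \<mu> \<in> N"
proof -
  let ?r = "path_restr E G act"
  obtain F where F: "finite F" "F \<subseteq> garrows G"
    and level: "\<forall>g\<in>garrows G. \<exists>n. {?r g \<mu> | \<mu>. \<mu> \<in> paths_to E (gdom G g) \<and> length \<mu> = n} \<subseteq> F"
    using assms(2) unfolding contracting_def by blast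
  obtain l where "\<forall>g\<in>garrows G. {?r g \<mu> | \<mu>. \<mu> \<in> paths_to E (gdom G g) \<and> length \<mu> = l g} \<subseteq> F"
    using bchoice[OF level] by blast
  then have l: "?r g \<mu> \<in> F" if "g \<in> garrows G" "\<mu> \<in> paths_to E (gdom G g)" "length \<mu> = l g" for g \<mu>
    using that by blast
  have "finite ((\<lambda>(g, e). l (edge_restr E G act g e)) ` (F \<times> arcs E))"
    using F fin by blast
  then obtain K where K: "\<And>g e. g \<in> F \<Longrightarrow> e \<in> arcs E \<Longrightarrow> l (edge_restr E G act g e) < K"
    unfolding finite_nat_set_iff_bounded by auto
  define N where "N = {?r g \<mu> | g \<mu>. g \<in> F \<and> \<mu> \<in> paths_to E (gdom G g) \<and> length \<mu> \<le> K}"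
  have "N \<subseteq> (\<lambda>(g, \<mu>). ?r g \<mu>) ` (F \<times> {\<mu>. set \<mu> \<subseteq> arcs E \<and> length \<mu> \<le> K})"
    unfolding N_def using set_paths_to by fastforce
  then have finN: "finite N"
    by (rule finite_subset) (use F fin finite_lists_length_le in blast)
  have NG: "N \<subseteq> garrows G"
    unfolding N_def using path_restr F by blast
  have absorb: "?r g \<mu> \<in> N" if "g \<in> F" "\<mu> \<in> paths_to E (gdom G g)" for g \<mu>
    using that
  proof (induction "length \<mu>" arbitrary: g \<mu> rule: less_induct)
    case less
    show ?case
    proof (cases "length \<mu> \<le> K")
      case True
      then show ?thesis using less by (auto simp: N_def)
    next
      case False
      \<comment> \<open>The first edge is split off so that the restriction back into \<open>F\<close> happens at a positive level.\<close>
      then obtain e \<mu>' where \<mu>: "\<mu> = e # \<mu>'"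
        by (cases \<mu>) auto
      let ?h = "edge_restr E G act g e"
      have g: "g \<in> garrows G" using less.prems F by blast
      have e: "e \<in> arcs E" "head E e = gdom G g" and \<mu>': "\<mu>' \<in> paths_to E (tail E e)"
        using less.prems \<mu> by auto
      have h: "?h \<in> garrows G" "gdom G ?h = tail E e"
        using edge_restr[OF g e] unfolding is_restriction_def by auto
      let ?\<alpha> = "take (l ?h) \<mu>'" and ?\<beta> = "drop (l ?h) \<mu>'"
      have \<alpha>: "?\<alpha> \<in> paths_to E (tail E e)" "?\<beta> \<in> paths_to E (path_source E (tail E e) ?\<alpha>)"
        using \<mu>' paths_to_append[of ?\<alpha> ?\<beta> "tail E e"] by auto
      have len: "l ?h \<le> length \<mu>'"
        using K[OF less.prems(1) e(1)] False \<mu> by simp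
      then have "?r ?h ?\<alpha> \<in> F"
        using l[OF h(1), of ?\<alpha>] h \<alpha> by simp
      moreover have "gdom G (?r ?h ?\<alpha>) = path_source E (tail E e) ?\<alpha>"
        using path_restr[OF h(1), of ?\<alpha>] h \<alpha> by simp
      moreover have "length ?\<beta> < length \<mu>"
        using \<mu> by simp
      ultimately have "?r (?r ?h ?\<alpha>) ?\<beta> \<in> N"
        using less.hyps[of ?\<beta> "?r ?h ?\<alpha>"] \<alpha> by simp
      then show ?thesis
        using path_restr_append[of ?h ?\<alpha> ?\<beta>] \<mu> by simp
    qed
  qed
  have "\<exists>n. \<forall>\<mu>\<in>paths_to E (gdom G g). n \<le> length \<mu> \<longrightarrow> ?r g \<mu> \<in> N" if g: "g \<in> garrows G" for g
  proof (intro exI[of _ "l g"] ballI impI)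
    fix \<mu> assume \<mu>: "\<mu> \<in> paths_to E (gdom G g)" and len: "l g \<le> length \<mu>"
    let ?\<alpha> = "take (l g) \<mu>" and ?\<beta> = "drop (l g) \<mu>"
    have \<alpha>: "?\<alpha> \<in> paths_to E (gdom G g)" "?\<beta> \<in> paths_to E (path_source E (gdom G g) ?\<alpha>)"
      using \<mu> paths_to_append[of ?\<alpha> ?\<beta> "gdom G g"] by auto
    have "?r g ?\<alpha> \<in> F"
      using l[OF g \<alpha>(1)] len by simp
    moreover have "gdom G (?r g ?\<alpha>) = path_source E (gdom G g) ?\<alpha>"
      using path_restr[OF g \<alpha>(1)] by simp
    ultimately have "?r (?r g ?\<alpha>) ?\<beta> \<in> N"
      using absorb \<alpha> by simp
    then show "?r g \<mu> \<in> N"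
      using path_restr_append[of g ?\<alpha> ?\<beta>] by simp
  qed
  with finN NG show ?thesis by (rule that)
qed

lemma left_segment_in_paths_to:
  "x \<in> left_inf_paths E \<Longrightarrow> left_segment x (Suc k) \<in> paths_to E (head E (x k))"
  by (induction k) (auto simp: left_segment_Suc left_inf_paths_def)

text \<open>The nucleus decouples the positions: a sequence with finitely many values becomes a
  separate choice in \<open>N\<close> for each \<open>k\<close>. Restricting the arrow at position
  \<open>n + k\<close> along its first \<open>n\<close> edges lands in \<open>N\<close>, and one
  \<open>n\<close> serves all \<open>k\<close> since only finitely many arrows occur.\<close>

lemma ae_left_iff_nucleus:
  assumes N: "finite N" "N \<subseteq> garrows G"
    "\<And>g. g \<in> garrows G \<Longrightarrow> \<exists>n. \<forall>\<mu>\<in>paths_to E (gdom G g). n \<le> length \<mu> \<longrightarrow> path_restr E G act g \<mu> \<in> N"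
  assumes xy: "x \<in> left_inf_paths E" "y \<in> left_inf_paths E"
  shows "(x, y) \<in> ae_left E G act \<longleftrightarrow>
    (\<forall>k. \<exists>h\<in>N. gdom G h = head E (x k) \<and> act h (left_segment x (Suc k)) = left_segment y (Suc k))"
proof
  assume "\<forall>k. \<exists>h\<in>N. gdom G h = head E (x k) \<and> act h (left_segment x (Suc k)) = left_segment y (Suc k)"
  then obtain g where g: "\<And>k. g k \<in> N" "\<And>k. gdom G (g k) = head E (x k)"
    "\<And>k. act (g k) (left_segment x (Suc k)) = left_segment y (Suc k)"
    by metis
  then have "finite (range g)"
    by (intro finite_subset[OF _ N(1)]) auto
  then show "(x, y) \<in> ae_left E G act"
    unfolding ae_left_def using g N(2) xy by blast
next
  assume "(x, y) \<in> ae_left E G act"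
  then obtain g where g: "finite (range g)" "\<And>k. g k \<in> garrows G" "\<And>k. gdom G (g k) = head E (x k)"
    "\<And>k. act (g k) (left_segment x (Suc k)) = left_segment y (Suc k)"
    unfolding ae_left_def by blast
  obtain l where l: "\<And>g \<mu>. g \<in> garrows G \<Longrightarrow> \<mu> \<in> paths_to E (gdom G g) \<Longrightarrow> l g \<le> length \<mu> \<Longrightarrow>
      path_restr E G act g \<mu> \<in> N"
    using N(3) by metis
  have "finite (l ` range g)"
    using g(1) by blast
  then obtain n where n: "\<And>k. l (g k) < n"
    unfolding finite_nat_set_iff_bounded by blast
  show "\<forall>k. \<exists>h\<in>N. gdom G h = head E (x k) \<and> act h (left_segment x (Suc k)) = left_segment y (Suc k)"
  proof
    fix k
    let ?\<mu> = "left_segment (\<lambda>i. x (i + Suc k)) n" and ?\<nu> = "left_segment x (Suc k)"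
    let ?g = "g (n + k)"
    let ?h = "path_restr E G act ?g ?\<mu>"
    have split: "left_segment x (Suc (n + k)) = ?\<mu> @ ?\<nu>"
      using left_segment_add[of x n "Suc k"] by simp
    have "?\<mu> @ ?\<nu> \<in> paths_to E (gdom G ?g)"
      using left_segment_in_paths_to[OF xy(1), of "n + k"] split g(3) by simp
    then have \<mu>: "?\<mu> \<in> paths_to E (gdom G ?g)" "?\<nu> \<in> paths_to E (path_source E (gdom G ?g) ?\<mu>)"
      by (auto simp: paths_to_append)
    then have src: "path_source E (gdom G ?g) ?\<mu> = head E (x k)"
      by (simp add: left_segment_Suc)
    have "?h \<in> N"
      using l[OF g(2) \<mu>(1)] n[of "n + k"] by simp
    moreover have "gdom G ?h = head E (x k)"
      using path_restr[OF g(2) \<mu>(1)] src by simp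
    moreover have "act ?h ?\<nu> = left_segment y (Suc k)"
    proof -
      have "left_segment (\<lambda>i. y (i + Suc k)) n @ left_segment y (Suc k) = act ?g ?\<mu> @ act ?h ?\<nu>"
        using path_restr[OF g(2) \<mu>(1)] \<mu>(2) g(4)[of "n + k"] split left_segment_add[of y n "Suc k"]
        by simp
      then show ?thesis
        using act_in(2)[OF g(2) \<mu>(1)] by (simp add: append_eq_append_conv)
    qed
    ultimately show "\<exists>h\<in>N. gdom G h = head E (x k) \<and> act h ?\<nu> = left_segment y (Suc k)"
      by blast
  qed
qed

section \<open>Asymptotic equivalence on one-sided and two-sided paths\<close>

lemma equiv_ae_left:
  assumes fin: "finite (verts E)"
  shows "equiv (left_inf_paths E) (ae_left E G act)"
proof (rule equivI)
  show "ae_left E G act \<subseteq> left_inf_paths E \<times> left_inf_paths E"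
    unfolding ae_left_def by auto
  show "refl_on (left_inf_paths E) (ae_left E G act)"
  proof (rule refl_onI)
    fix x assume x: "x \<in> left_inf_paths E"
    let ?g = "\<lambda>k. gunit G (head E (x k))"
    have v: "head E (x k) \<in> verts E" for k
      using x by (auto simp: left_inf_paths_def)
    have "range ?g \<subseteq> gunit G ` verts E"
      using v by auto
    then have "finite (range ?g)"
      using fin finite_subset by blast
    then show "(x, x) \<in> ae_left E G act"
      unfolding ae_left_def using x v unit_in dom_unit act_unit left_segment_in_paths_to by blast
  qed
  show "sym (ae_left E G act)"
  proof (rule symI)
    fix x y assume "(x, y) \<in> ae_left E G act"
    then obtain g where xy: "x \<in> left_inf_paths E" "y \<in> left_inf_paths E"
      and g: "finite (range g)" "\<And>k. g k \<in> garrows G" "\<And>k. gdom G (g k) = head E (x k)"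
      "\<And>k. act (g k) (left_segment x (Suc k)) = left_segment y (Suc k)"
      unfolding ae_left_def by blast
    obtain i where i: "\<And>g. g \<in> garrows G \<Longrightarrow> i g \<in> garrows G \<and> gdom G (i g) = gcod G g \<and>
        gcod G (i g) = gdom G g \<and> gmult G (i g) g = gunit G (gdom G g)"
      using inverse by metis
    have "finite (range (\<lambda>k. i (g k)))"
      using finite_imageI[OF g(1), of i] by (simp add: image_image)
    moreover have "i (g k) \<in> garrows G \<and> gdom G (i (g k)) = head E (y k) \<and>
        act (i (g k)) (left_segment y (Suc k)) = left_segment x (Suc k)" for k
    proof -
      have p: "left_segment x (Suc k) \<in> paths_to E (gdom G (g k))"
        using left_segment_in_paths_to[OF xy(1)] g(3) by simp
      have "left_segment y (Suc k) \<in> paths_to E (gcod G (g k))"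
        using act_in(1)[OF g(2) p] g(4) by simp
      then have "head E (y k) = gcod G (g k)"
        by (simp add: left_segment_Suc)
      moreover have "act (i (g k)) (left_segment y (Suc k)) = act (gmult G (i (g k)) (g k)) (left_segment x (Suc k))"
        using act_mult[of "i (g k)" "g k"] i[OF g(2)] g(2) p g(4) by simp
      ultimately show ?thesis
        using i[OF g(2)[of k]] p act_unit dom_in[OF g(2)] by simp
    qed
    ultimately show "(y, x) \<in> ae_left E G act"
      unfolding ae_left_def using xy by blast
  qed
  show "trans (ae_left E G act)"
  proof (rule transI)
    fix x y z assume "(x, y) \<in> ae_left E G act" "(y, z) \<in> ae_left E G act"
    then obtain g h where xyz: "x \<in> left_inf_paths E" "y \<in> left_inf_paths E" "z \<in> left_inf_paths E"
      and g: "finite (range g)" "\<And>k. g k \<in> garrows G" "\<And>k. gdom G (g k) = head E (x k)"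
      "\<And>k. act (g k) (left_segment x (Suc k)) = left_segment y (Suc k)"
      and h: "finite (range h)" "\<And>k. h k \<in> garrows G" "\<And>k. gdom G (h k) = head E (y k)"
      "\<And>k. act (h k) (left_segment y (Suc k)) = left_segment z (Suc k)"
      unfolding ae_left_def by blast
    have "range (\<lambda>k. gmult G (h k) (g k)) \<subseteq> (\<lambda>(a, b). gmult G a b) ` (range h \<times> range g)"
      by auto
    then have "finite (range (\<lambda>k. gmult G (h k) (g k)))"
      by (rule finite_subset) (use g h in blast)
    moreover have "gmult G (h k) (g k) \<in> garrows G \<and> gdom G (gmult G (h k) (g k)) = head E (x k) \<and>
        act (gmult G (h k) (g k)) (left_segment x (Suc k)) = left_segment z (Suc k)" for k
    proof -
      have p: "left_segment x (Suc k) \<in> paths_to E (gdom G (g k))"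
        using left_segment_in_paths_to[OF xyz(1)] g(3) by simp
      have "left_segment y (Suc k) \<in> paths_to E (gcod G (g k))"
        using act_in(1)[OF g(2) p] g(4) by simp
      then have "gdom G (h k) = gcod G (g k)"
        using h(3) by (simp add: left_segment_Suc)
      then show ?thesis
        using mult_in[OF h(2) g(2)] dom_mult[OF h(2) g(2)] act_mult[OF h(2) g(2) _ p] g h by simp
    qed
    ultimately show "(x, z) \<in> ae_left E G act"
      unfolding ae_left_def using xyz by blast
  qed
qed

lemma ae_left_left_shift:
  assumes "(x, y) \<in> ae_left E G act"
  shows "(left_shift x, left_shift y) \<in> ae_left E G act"
proof -
  obtain g where xy: "x \<in> left_inf_paths E" "y \<in> left_inf_paths E"
    and g: "finite (range g)" "\<And>k. g k \<in> garrows G" "\<And>k. gdom G (g k) = head E (x k)"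
      "\<And>k. act (g k) (left_segment x (Suc k)) = left_segment y (Suc k)"
    using assms unfolding ae_left_def by blast
  have "range (\<lambda>k. g (Suc k)) \<subseteq> range g"
    by auto
  then have "finite (range (\<lambda>k. g (Suc k)))"
    using g(1) finite_subset by blast
  moreover have "act (g (Suc k)) (left_segment (left_shift x) (Suc k)) = left_segment (left_shift y) (Suc k)" for k
    using take_act[OF g(2)[of "Suc k"], of "left_segment (left_shift x) (Suc k)" "[x 0]"]
      left_segment_in_paths_to[OF xy(1), of "Suc k"] g(3)[of "Suc k"] g(4)[of "Suc k"]
    unfolding left_segment_left_shift[of _ "Suc k"] by simp
  moreover have "left_shift x \<in> left_inf_paths E" "left_shift y \<in> left_inf_paths E"
    using xy by (auto simp: left_inf_paths_def left_shift_def)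
  ultimately show ?thesis
    unfolding ae_left_def using g(2,3) by (auto simp: left_shift_def intro!: exI[of _ "\<lambda>k. g (Suc k)"])
qed

text \<open>\<open>act_inf\<close> reads each edge off the image of a different initial segment; by
  \<open>take_act\<close> these images are prefixes of one another.\<close>

lemma act_initial_segment:
  assumes g: "g \<in> garrows G" and y: "\<And>n. map y [0..<n] \<in> paths_to E (gdom G g)"
  shows "act g (map y [0..<n]) = map (act_inf act g y) [0..<n]"
proof (rule nth_equalityI)
  fix i assume "i < length (act g (map y [0..<n]))"
  then have i: "i < n"
    using act_in(2)[OF g y] by simp
  have split: "map y [0..<n] = map y [0..<Suc i] @ map y [Suc i..<n]"
    using upt_split[of "Suc i" n] i by (simp del: upt_Suc flip: map_append)
  have "take (Suc i) (act g (map y [0..<n])) = act g (map y [0..<Suc i])"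
    using take_act[OF g, of "map y [0..<Suc i]" "map y [Suc i..<n]"] y[of n] split by simp
  then have "act g (map y [0..<n]) ! i = act g (map y [0..<Suc i]) ! i"
    using nth_take[of i "Suc i" "act g (map y [0..<n])"] by simp
  then show "act g (map y [0..<n]) ! i = map (act_inf act g y) [0..<n] ! i"
    using i by (simp add: act_inf_def)
qed (use act_in(2)[OF g y] in simp)

lemma right_half_initial_segment:
  assumes x: "x \<in> bi_inf_paths E"
  shows "map (right_half x n) [0..<k] \<in> paths_to E (head E (x n))"
proof (induction k arbitrary: n)
  case 0
  have "head E (x n) \<in> verts E"
    using x by (auto simp: bi_inf_paths_def)
  then show ?case by simp
next
  case (Suc k)
  have "map (right_half x n) [0..<Suc k] = x n # map (right_half x (n + 1)) [0..<k]"
    unfolding upt_conv_Cons[OF zero_less_Suc] map_Suc_upt[symmetric]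
    by (simp add: right_half_def algebra_simps)
  then show ?case
    using Suc[of "n + 1"] x by (simp add: bi_inf_paths_def)
qed

text \<open>From left to right the same arrows are reindexed. Conversely, the arrows obtained from
  the left halves vary with \<open>m\<close>, while \<open>ae_bi\<close> wants one arrow per
  position for an entire infinite path. Taken from a finite nucleus, some arrow serves arbitrarily
  long segments, hence all; the nucleus also keeps the range finite.\<close>

lemma ae_bi_iff:
  assumes fin: "finite (arcs E)" and contr: "contracting E G act"
  shows "(x, y) \<in> ae_bi E G act \<longleftrightarrow> x \<in> bi_inf_paths E \<and> y \<in> bi_inf_paths E \<and>
    (\<forall>m::nat. (left_half x (int m), left_half y (int m)) \<in> ae_left E G act)"
proof safe
  assume "(x, y) \<in> ae_bi E G act"
  then obtain g where xy: "x \<in> bi_inf_paths E" "y \<in> bi_inf_paths E"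
    and g: "finite (range g)" "\<And>n. g n \<in> garrows G" "\<And>n. gdom G (g n) = head E (x n)"
    "\<And>n. act_inf act (g n) (right_half x n) = right_half y n"
    unfolding ae_bi_def by blast
  show "x \<in> bi_inf_paths E" "y \<in> bi_inf_paths E" by fact+
  fix m :: nat
  let ?g = "\<lambda>k. g (int m - int k)"
  have "range ?g \<subseteq> range g" by auto
  then have "finite (range ?g)"
    using g(1) finite_subset by blast
  moreover have "act (?g k) (left_segment (left_half x (int m)) (Suc k)) = left_segment (left_half y (int m)) (Suc k)" for k
    unfolding left_segment_left_half
    using act_initial_segment[OF g(2), of "right_half x (int m - int k)" "int m - int k" "Suc k"]
      right_half_initial_segment[OF xy(1)] g(3,4) by simp
  moreover have "left_half x (int m) \<in> left_inf_paths E" "left_half y (int m) \<in> left_inf_paths E"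
    using xy by (auto simp: left_half_in)
  ultimately show "(left_half x (int m), left_half y (int m)) \<in> ae_left E G act"
    unfolding ae_left_def using g(2,3) by (auto simp: left_half_def intro!: exI[of _ ?g])
next
  assume xy: "x \<in> bi_inf_paths E" "y \<in> bi_inf_paths E"
    and ae: "\<forall>m::nat. (left_half x (int m), left_half y (int m)) \<in> ae_left E G act"
  obtain N where N: "finite N" "N \<subseteq> garrows G"
    "\<And>g. g \<in> garrows G \<Longrightarrow> \<exists>n. \<forall>\<mu>\<in>paths_to E (gdom G g). n \<le> length \<mu> \<longrightarrow> path_restr E G act g \<mu> \<in> N"
    using finite_nucleus[OF fin contr] by metis
  \<comment> \<open>\<open>?A n k h\<close>: the arrow \<open>h\<close> maps \<open>x\<^sub>n \<dots> x\<^bsub>n+k\<^esub>\<close> to \<open>y\<^sub>n \<dots> y\<^bsub>n+k\<^esub>\<close>.  As the nucleus is finite,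
    a single \<open>h\<close> works for all \<open>k\<close>.\<close>
  let ?A = "\<lambda>n k h. act h (map (right_half x n) [0..<Suc k]) = map (right_half y n) [0..<Suc k]"
  have ex: "\<exists>k'\<ge>k. \<exists>h\<in>N. gdom G h = head E (x n) \<and> ?A n k' h" for n k
  proof -
    \<comment> \<open>\<open>ae\<close> speaks of halves that end at natural numbers only. For
      negative \<open>n + k\<close> the half ending at 0 is used, and the segment becomes longer
      than asked for.\<close>
    define m where "m = nat (max 0 (n + int k))"
    define k' where "k' = nat (int m - n)"
    have k': "k \<le> k'" "int m - int k' = n"
      by (auto simp: m_def k'_def)
    have "\<exists>h\<in>N. gdom G h = head E (left_half x (int m) k') \<and>
        act h (left_segment (left_half x (int m)) (Suc k')) = left_segment (left_half y (int m)) (Suc k')"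
      using ae_left_iff_nucleus[OF N left_half_in[OF xy(1)] left_half_in[OF xy(2)], of "int m" "int m"] ae by blast
    then show ?thesis
      unfolding left_segment_left_half k'(2) using k' by (auto simp: left_half_def)
  qed
  have mono: "?A n k h" if "h \<in> N" "gdom G h = head E (x n)" "?A n k' h" "k \<le> k'" for n k k' h
  proof -
    have h: "h \<in> garrows G" using that N by blast
    have dec: "map f [0..<Suc k'] = map f [0..<Suc k] @ map f [Suc k..<Suc k']" for f :: "nat \<Rightarrow> 'e"
      using upt_split[of "Suc k" "Suc k'"] that(4) by (simp del: upt_Suc flip: map_append)
    have "take (Suc k) (act h (map (right_half x n) [0..<Suc k'])) = act h (map (right_half x n) [0..<Suc k])"
      using take_act[OF h, of "map (right_half x n) [0..<Suc k]" "map (right_half x n) [Suc k..<Suc k']"]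
        right_half_initial_segment[OF xy(1), of n "Suc k'"] that(2)
      unfolding dec[symmetric] by simp
    then show ?thesis
      unfolding that(3) using that(4) by (simp add: take_map del: upt_Suc)
  qed
  have "\<exists>h. h \<in> N \<and> gdom G h = head E (x n) \<and> (\<forall>k. ?A n k h)" for n
  proof (rule ccontr)
    assume "\<nexists>h. h \<in> N \<and> gdom G h = head E (x n) \<and> (\<forall>k. ?A n k h)"
    then obtain f where f: "\<And>h. h \<in> N \<Longrightarrow> gdom G h = head E (x n) \<Longrightarrow> \<not> ?A n (f h) h"
      by metis
    have "finite (f ` N)" using N by blast
    then obtain K where K: "\<And>h. h \<in> N \<Longrightarrow> f h < K"
      unfolding finite_nat_set_iff_bounded by blast
    obtain k' h where h: "k' \<ge> K" "h \<in> N" "gdom G h = head E (x n)" "?A n k' h"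
      using ex[of K n] by blast
    then have "?A n (f h) h"
      using K[OF h(2)] by (intro mono[OF h(2,3,4)]) simp
    then show False
      using f h by blast
  qed
  then obtain g where g: "\<And>n. g n \<in> N" "\<And>n. gdom G (g n) = head E (x n)" "\<And>n k. ?A n k (g n)"
    by metis
  have "finite (range g)"
    using g(1) by (intro finite_subset[OF _ N(1)]) auto
  moreover have "act_inf act (g n) (right_half x n) = right_half y n" for n
    unfolding act_inf_def g(3) by (simp del: upt_Suc)
  ultimately show "(x, y) \<in> ae_bi E G act"
    unfolding ae_bi_def using xy g(1,2) N(2) by blast
qed

lemma equiv_ae_bi:
  assumes "finite (verts E)" "finite (arcs E)" "contracting E G act"
  shows "equiv (bi_inf_paths E) (ae_bi E G act)"
proof (rule equivI)
  note iff = ae_bi_iff[OF assms(2,3)]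
  have refl: "refl_on (left_inf_paths E) (ae_left E G act)" and sym: "sym (ae_left E G act)"
    and trans: "trans (ae_left E G act)"
    using equiv_ae_left[OF assms(1)] by (auto elim: equivE)
  show "ae_bi E G act \<subseteq> bi_inf_paths E \<times> bi_inf_paths E"
    unfolding ae_bi_def by auto
  show "refl_on (bi_inf_paths E) (ae_bi E G act)"
    using refl_onD[OF refl left_half_in] iff by (intro refl_onI) blast
  show "sym (ae_bi E G act)"
    using symD[OF sym] iff by (intro symI) blast
  show "trans (ae_bi E G act)"
    using transD[OF trans] iff by (intro transI) blast
qed

end

section \<open>The solenoid as an inverse limit\<close>

locale contracting_action = self_similar_action +
  assumes finite_verts: "finite (verts E)" and finite_arcs: "finite (arcs E)"
    and contr: "contracting E G act" and no_sources: "no_sources E"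
begin

section \<open>Coordinates and translations of the solenoid\<close>

abbreviation "solenoid \<equiv> limit_solenoid E G act"

text \<open>On an actual class the union is over equal sets. Coordinates at negative positions would
  be images of \<open>coord 0\<close> under iterates of the limit shift.\<close>

definition coord :: "nat \<Rightarrow> (int \<Rightarrow> 'b) set \<Rightarrow> (nat \<Rightarrow> 'b) set" where
  "coord m a = (\<Union>x\<in>a. left_class E G act (left_half x (int m)))"

text \<open>\<open>translate (- 1)\<close> is the map induced by \<open>bi_shift\<close>; admitting
  all integers provides its inverse as \<open>translate 1\<close>.\<close>

definition translate :: "int \<Rightarrow> (int \<Rightarrow> 'b) set \<Rightarrow> (int \<Rightarrow> 'b) set" where
  "translate i a = (\<Union>x\<in>a. bi_class E G act (\<lambda>n. x (n + i)))"

lemmas equiv_left = equiv_ae_left[OF finite_verts]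
lemmas equiv_bi = equiv_ae_bi[OF finite_verts finite_arcs contr]
lemmas ae_bi_iff_left = ae_bi_iff[OF finite_arcs contr]

lemma topspace_solenoid: "topspace solenoid = bi_inf_paths E // ae_bi E G act"
  by (simp add: limit_solenoid_def topspace_quotient_topology)

lemma topspace_limit_space: "topspace (limit_space E G act) = left_inf_paths E // ae_left E G act"
  by (simp add: limit_space_def topspace_quotient_topology)

lemma quotient_map_solenoid: "quotient_map (bi_inf_topology E) solenoid (\<lambda>x. bi_class E G act x)"
  unfolding limit_solenoid_def by (rule quotient_map_quotient_topology)

lemma bi_class_in: "x \<in> bi_inf_paths E \<Longrightarrow> bi_class E G act x \<in> topspace solenoid"
  by (simp add: topspace_solenoid quotientI)

lemma solenoid_cases:
  assumes "a \<in> topspace solenoid"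
  obtains x where "x \<in> bi_inf_paths E" "a = bi_class E G act x"
  using assms unfolding topspace_solenoid by (rule quotientE)

lemma coord_bi_class:
  assumes "x \<in> bi_inf_paths E"
  shows "coord m (bi_class E G act x) = left_class E G act (left_half x (int m))"
  unfolding coord_def
proof (rule UN_equiv_class[OF equiv_bi _ assms])
  show "(\<lambda>x. left_class E G act (left_half x (int m))) respects ae_bi E G act"
    using ae_bi_iff_left equiv_class_eq[OF equiv_left] by (intro congruentI) blast
qed

lemma ae_bi_translate:
  assumes "(x, y) \<in> ae_bi E G act"
  shows "(\<lambda>n. x (n + i), \<lambda>n. y (n + i)) \<in> ae_bi E G act"
proof -
  obtain g where xy: "x \<in> bi_inf_paths E" "y \<in> bi_inf_paths E" and g: "finite (range g)"
    "\<And>n. g n \<in> garrows G \<and> gdom G (g n) = head E (x n) \<and>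
       act_inf act (g n) (right_half x n) = right_half y n"
    using assms unfolding ae_bi_def by blast
  have half: "right_half (\<lambda>n. z (n + i)) n = right_half z (n + i)" for z :: "int \<Rightarrow> 'b" and n
    by (auto simp: right_half_def algebra_simps)
  have "range (\<lambda>n. g (n + i)) \<subseteq> range g" by auto
  then have "finite (range (\<lambda>n. g (n + i)))"
    using g(1) finite_subset by blast
  then show ?thesis
    unfolding ae_bi_def using bi_translate_in[OF xy(1), of i] bi_translate_in[OF xy(2), of i] g(2)
    by (auto simp: half intro!: exI[of _ "\<lambda>n. g (n + i)"])
qed

lemma translate_bi_class:
  assumes "x \<in> bi_inf_paths E"
  shows "translate i (bi_class E G act x) = bi_class E G act (\<lambda>n. x (n + i))"
  unfolding translate_def
proof (rule UN_equiv_class[OF equiv_bi _ assms])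
  show "(\<lambda>x. bi_class E G act (\<lambda>n. x (n + i))) respects ae_bi E G act"
    using ae_bi_translate equiv_class_eq[OF equiv_bi] by (intro congruentI) blast
qed

lemma limit_shift_left_class:
  assumes "x \<in> left_inf_paths E"
  shows "limit_shift E G act (left_class E G act x) = left_class E G act (left_shift x)"
  unfolding limit_shift_def
proof (rule UN_equiv_class[OF equiv_left _ assms])
  show "(\<lambda>x. left_class E G act (left_shift x)) respects ae_left E G act"
    using ae_left_left_shift equiv_class_eq[OF equiv_left] by (intro congruentI) blast
qed

lemma continuous_coord: "continuous_map solenoid (limit_space E G act) (coord m)"
proof (rule continuous_compose_quotient_map[OF quotient_map_solenoid])
  have "continuous_map (left_inf_topology E) (limit_space E G act) (\<lambda>x. left_class E G act x)"
    unfolding limit_space_def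
    by (rule quotient_imp_continuous_map[OF quotient_map_quotient_topology])
  then have "continuous_map (bi_inf_topology E) (limit_space E G act)
      ((\<lambda>x. left_class E G act x) \<circ> (\<lambda>x. left_half x (int m)))"
    by (rule continuous_map_compose[OF continuous_left_half])
  then show "continuous_map (bi_inf_topology E) (limit_space E G act) (coord m \<circ> (\<lambda>x. bi_class E G act x))"
    by (rule continuous_map_eq) (simp add: coord_bi_class)
qed

lemma continuous_translate: "continuous_map solenoid solenoid (translate i)"
proof (rule continuous_compose_quotient_map[OF quotient_map_solenoid])
  have "continuous_map (bi_inf_topology E) solenoid ((\<lambda>x. bi_class E G act x) \<circ> (\<lambda>x n. x (n + i)))"
    by (rule continuous_map_compose[OF continuous_bi_translate
          quotient_imp_continuous_map[OF quotient_map_solenoid]])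
  then show "continuous_map (bi_inf_topology E) solenoid (translate i \<circ> (\<lambda>x. bi_class E G act x))"
    by (rule continuous_map_eq) (simp add: translate_bi_class)
qed

lemma translate_translate:
  "a \<in> topspace solenoid \<Longrightarrow> translate i (translate j a) = translate (i + j) a"
  by (erule solenoid_cases) (simp add: translate_bi_class bi_translate_in algebra_simps)

lemma translate_0: "a \<in> topspace solenoid \<Longrightarrow> translate 0 a = a"
  by (erule solenoid_cases) (simp add: translate_bi_class)

lemma homeomorphic_map_translate: "homeomorphic_map solenoid solenoid (translate i)"
proof -
  have "homeomorphic_maps solenoid solenoid (translate i) (translate (- i))"
    unfolding homeomorphic_maps_def using continuous_translate
    by (simp add: translate_translate translate_0)
  then show ?thesis
    using homeomorphic_map_maps by blast
qed

lemma translate_bi_shift: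
  "x \<in> bi_inf_paths E \<Longrightarrow> translate (- 1) (bi_class E G act x) = bi_class E G act (bi_shift x)"
  by (simp add: translate_bi_class bi_shift_def)

lemma funpow_translate:
  assumes "x \<in> bi_inf_paths E"
  shows "(translate (- 1) ^^ N) (bi_class E G act x) = bi_class E G act (\<lambda>n. x (n - int N))"
proof (induction N)
  case (Suc N)
  have "(\<lambda>n. x (n - int N)) \<in> bi_inf_paths E"
    using bi_translate_in[OF assms, of "- int N"] by simp
  then show ?case
    using Suc by (simp add: translate_bi_class algebra_simps)
qed simp

lemma compact_solenoid: "compact_space solenoid"
proof -
  have "compactin solenoid ((\<lambda>x. bi_class E G act x) ` topspace (bi_inf_topology E))"
    using compact_space_bi_inf_topology[OF finite_arcs] unfolding compact_space_def
    by (rule image_compactin[OF _ quotient_imp_continuous_map[OF quotient_map_solenoid]])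
  then show ?thesis
    unfolding compact_space_def quotient_imp_surjective_map[OF quotient_map_solenoid] .
qed

lemma natural_extension_solenoid:
  assumes "\<epsilon> > 0" "c > 1" and top: "mtopology_of dJ = limit_space E G act"
    and "\<And>a b. \<lbrakk>a \<in> mspace dJ; b \<in> mspace dJ; mdist dJ a b < \<epsilon>\<rbrakk> \<Longrightarrow>
      mdist dJ (limit_shift E G act a) (limit_shift E G act b) = c * mdist dJ a b"
    and "\<And>a \<alpha>. \<lbrakk>a \<in> mspace dJ; 0 < \<alpha>; \<alpha> \<le> \<epsilon>\<rbrakk> \<Longrightarrow>
      limit_shift E G act ` mball_of dJ a \<alpha> = mball_of dJ (limit_shift E G act a) (c * \<alpha>)"
  shows "natural_extension solenoid dJ (limit_shift E G act) coord (translate (- 1)) \<epsilon> c"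
proof
  have space: "mspace dJ = left_inf_paths E // ae_left E G act"
    using topspace_mtopology_of[of dJ] topspace_limit_space top by simp
  show "compact_space solenoid" by (rule compact_solenoid)
  show "continuous_map solenoid (mtopology_of dJ) (coord m)" for m
    unfolding top by (rule continuous_coord)
  show "homeomorphic_map solenoid solenoid (translate (- 1))"
    by (rule homeomorphic_map_translate)
  show "limit_shift E G act (coord (Suc m) z) = coord m z" if "z \<in> topspace solenoid" for z m
    using that by (rule solenoid_cases)
      (simp add: coord_bi_class limit_shift_left_class left_half_in left_shift_left_half)
  show "coord 0 (translate (- 1) z) = limit_shift E G act (coord 0 z)" if "z \<in> topspace solenoid" for z
    using that
  proof (rule solenoid_cases)
    fix x assume x: "x \<in> bi_inf_paths E" "z = bi_class E G act x"
    then have "bi_shift x \<in> bi_inf_paths E"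
      using bi_translate_in[of x E "- 1"] by (simp add: bi_shift_def)
    then show ?thesis
      using x by (simp add: translate_bi_shift coord_bi_class limit_shift_left_class left_half_in
          left_shift_left_half left_half_bi_shift)
  qed
  show "coord (Suc m) (translate (- 1) z) = coord m z" if "z \<in> topspace solenoid" for z m
    using that
  proof (rule solenoid_cases)
    fix x assume x: "x \<in> bi_inf_paths E" "z = bi_class E G act x"
    then have "bi_shift x \<in> bi_inf_paths E"
      using bi_translate_in[of x E "- 1"] by (simp add: bi_shift_def)
    then show ?thesis
      using x by (simp add: translate_bi_shift coord_bi_class left_half_bi_shift)
  qed
  show "x = y" if xy: "x \<in> topspace solenoid" "y \<in> topspace solenoid" and eq: "\<And>m. coord m x = coord m y" for x y
  proof -
    obtain u where u: "u \<in> bi_inf_paths E" "x = bi_class E G act u"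
      using xy(1) by (rule solenoid_cases)
    obtain v where v: "v \<in> bi_inf_paths E" "y = bi_class E G act v"
      using xy(2) by (rule solenoid_cases)
    have "(left_half u (int m), left_half v (int m)) \<in> ae_left E G act" for m
      using eq[of m] u v left_half_in
      by (intro eq_equiv_class[OF _ equiv_left]) (auto simp: coord_bi_class)
    then have "(u, v) \<in> ae_bi E G act"
      using u v ae_bi_iff_left by blast
    then show "x = y"
      unfolding u v by (rule equiv_class_eq[OF equiv_bi])
  qed
  show "\<exists>z\<in>topspace solenoid. coord m z = a" if a: "a \<in> mspace dJ" for a m
  proof -
    obtain x where x: "x \<in> left_inf_paths E" "a = left_class E G act x"
      using a unfolding space by (rule quotientE)
    obtain y where "y \<in> bi_inf_paths E" "left_half y (int m) = x"
      using ex_bi_inf_extension[OF no_sources x(1)] by blast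
    then show ?thesis
      using x(2) by (intro bexI[OF _ bi_class_in]) (auto simp: coord_bi_class)
  qed
qed (fact assms)+

section \<open>Irreducibility and mixing\<close>

text \<open>If \<open>U\<close> and \<open>V\<close> contain the classes of the cylinders of \<open>z\<close> and \<open>w\<close> on \<open>[-n, n]\<close>, join
  \<open>w\<^bsub>-n\<^esub> \<dots> w\<^sub>n\<close> to \<open>z\<^bsub>-n\<^esub> \<dots> z\<^sub>n\<close> by a path.\<close>

lemma open_sets_meet:
  assumes U: "openin solenoid U" "U \<noteq> {}" and V: "openin solenoid V" "V \<noteq> {}"
  obtains v w n where "v \<in> verts E" "w \<in> verts E"
    "\<And>\<mu>. is_path E v \<mu> w \<Longrightarrow> (translate (- 1) ^^ (2 * n + 1 + length \<mu>)) ` U \<inter> V \<noteq> {}"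
proof -
  have cyl: "\<exists>z n. z \<in> bi_inf_paths E \<and>
      (\<forall>x\<in>bi_inf_paths E. (\<forall>k\<in>{- int n..int n}. x k = z k) \<longrightarrow> bi_class E G act x \<in> W)"
    if W: "openin solenoid W" "W \<noteq> {}" for W
  proof -
    let ?W = "{x \<in> topspace (bi_inf_topology E). bi_class E G act x \<in> W}"
    have open_W: "openin (bi_inf_topology E) ?W"
      using W(1) unfolding limit_solenoid_def openin_quotient_topology by blast
    obtain a where "a \<in> W" using W by blast
    moreover then have "a \<in> topspace solenoid" using W openin_subset by blast
    ultimately obtain z where z: "z \<in> ?W"
      by (auto elim: solenoid_cases)
    then show ?thesis
      using openin_bi_inf_contains_cylinder[OF open_W z] by (auto 0 4)
  qed
  obtain z n1 where z: "z \<in> bi_inf_paths E"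
    "\<And>x. x \<in> bi_inf_paths E \<Longrightarrow> \<forall>k\<in>{- int n1..int n1}. x k = z k \<Longrightarrow> bi_class E G act x \<in> U"
    using cyl[OF U] by blast
  obtain w n2 where w: "w \<in> bi_inf_paths E"
    "\<And>x. x \<in> bi_inf_paths E \<Longrightarrow> \<forall>k\<in>{- int n2..int n2}. x k = w k \<Longrightarrow> bi_class E G act x \<in> V"
    using cyl[OF V] by blast
  define n where "n = max n1 n2"
  show ?thesis
  proof (rule that)
    show "tail E (w (int n)) \<in> verts E" "head E (z (- int n)) \<in> verts E"
      using z(1) w(1) by (auto simp: bi_inf_paths_def)
    fix \<mu> assume "is_path E (tail E (w (int n))) \<mu> (head E (z (- int n)))"
    then obtain x where x: "x \<in> bi_inf_paths E" "\<And>k. k \<ge> - int n \<Longrightarrow> x k = z k"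
      "\<And>k. k \<le> int n \<Longrightarrow> x (k - (2 * int n + 1 + int (length \<mu>))) = w k"
      using ex_glued_path[OF z(1) w(1), of "int n" \<mu>] by auto
    \<comment> \<open>Translating \<open>?N\<close> times undoes the displacement of
      \<open>w\<close> in the glued path and so brings the copy of \<open>w\<close> back to the
      window around 0.\<close>
    let ?N = "2 * n + 1 + length \<mu>"
    have "bi_class E G act x \<in> U"
      using x by (intro z(2)) (auto simp: n_def)
    moreover have "(translate (- 1) ^^ ?N) (bi_class E G act x) \<in> V"
      unfolding funpow_translate[OF x(1)]
    proof (rule w(2))
      show "(\<lambda>k. x (k - int ?N)) \<in> bi_inf_paths E"
        using bi_translate_in[OF x(1), of "- int ?N"] by (simp only: diff_conv_add_uminus)
      show "\<forall>k\<in>{- int n2..int n2}. x (k - int ?N) = w k"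
        using x(3) by (auto simp: n_def algebra_simps)
    qed
    ultimately show "(translate (- 1) ^^ ?N) ` U \<inter> V \<noteq> {}"
      by blast
  qed
qed

text \<open>The summand 1 in \<open>2 * n + 1 + length \<mu>\<close> makes the exponent positive
  even when the connecting path is empty.\<close>

lemma irreducible_solenoid:
  assumes "strongly_connected_graph E"
  shows "irreducible_system solenoid (translate (- 1))"
  unfolding irreducible_system_def
proof (intro allI impI, elim conjE)
  fix U V assume "openin solenoid U" "U \<noteq> {}" "openin solenoid V" "V \<noteq> {}"
  then obtain n v w where vw: "v \<in> verts E" "w \<in> verts E"
    "\<And>\<mu>. is_path E v \<mu> w \<Longrightarrow> (translate (- 1) ^^ (2 * n + 1 + length \<mu>)) ` U \<inter> V \<noteq> {}"
    by (rule open_sets_meet) blast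
  obtain \<mu> where "is_path E v \<mu> w"
    using assms vw(1,2) unfolding strongly_connected_graph_def by blast
  then show "\<exists>N\<ge>1. (translate (- 1) ^^ N) ` U \<inter> V \<noteq> {}"
    by (intro exI[of _ "2 * n + 1 + length \<mu>"] conjI vw(3)) auto
qed

text \<open>The endpoints \<open>v\<close> and \<open>w\<close> depend only on the open sets, and
  between them there are paths of every length from \<open>l\<close> on, so every large exponent
  occurs.\<close>

lemma mixing_solenoid:
  assumes "primitive_graph E"
  shows "mixing_system solenoid (translate (- 1))"
  unfolding mixing_system_def
proof (intro allI impI, elim conjE)
  fix U V assume "openin solenoid U" "U \<noteq> {}" "openin solenoid V" "V \<noteq> {}"
  then obtain n v w where vw: "v \<in> verts E" "w \<in> verts E"
    "\<And>\<mu>. is_path E v \<mu> w \<Longrightarrow> (translate (- 1) ^^ (2 * n + 1 + length \<mu>)) ` U \<inter> V \<noteq> {}"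
    by (rule open_sets_meet) blast
  obtain l where l: "\<forall>v\<in>verts E. \<forall>w\<in>verts E. \<exists>\<mu>. length \<mu> = l \<and> is_path E v \<mu> w"
    using assms unfolding primitive_graph_def by blast
  show "\<exists>N. \<forall>m\<ge>N. (translate (- 1) ^^ m) ` U \<inter> V \<noteq> {}"
  proof (intro exI[of _ "2 * n + 1 + l"] allI impI)
    fix m assume m: "2 * n + 1 + l \<le> m"
    obtain \<mu> where \<mu>: "length \<mu> = l + (m - (2 * n + 1 + l))" "is_path E v \<mu> w"
      using paths_of_larger_length[OF no_sources l vw(1,2)] by blast
    then have "2 * n + 1 + length \<mu> = m"
      using m by simp
    then show "(translate (- 1) ^^ m) ` U \<inter> V \<noteq> {}"
      using vw(3)[OF \<mu>(2)] by simp
  qed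
qed

end

theorem corollary5p5:
  fixes E :: "('v, 'e) pre_digraph"
    and G :: "('g, 'v) groupoid_data"
    and act :: "'g \<Rightarrow> 'e list \<Rightarrow> 'e list"
  assumes "fin_digraph E" and "no_sinks E" and "no_sources E"
    and "self_similar_action E G act"
    and "contracting E G act"
    and "regular_action E G act"
  shows "\<exists>\<tau>' :: (int \<Rightarrow> 'e) set \<Rightarrow> (int \<Rightarrow> 'e) set.
    homeomorphic_map (limit_solenoid E G act) (limit_solenoid E G act) \<tau>' \<and>
    (\<forall>x\<in>bi_inf_paths E. \<tau>' (bi_class E G act x) = bi_class E G act (bi_shift x)) \<and>
    (\<forall>(\<epsilon>::real) (c::real) (dJ :: (nat \<Rightarrow> 'e) set metric).
       \<epsilon> > 0 \<and> c > 1 \<and>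
       mtopology_of dJ = limit_space E G act \<and>
       (\<forall>a\<in>mspace dJ. \<forall>b\<in>mspace dJ. mdist dJ a b < \<epsilon> \<longrightarrow>
          mdist dJ (limit_shift E G act a) (limit_shift E G act b) = c * mdist dJ a b) \<and>
       (\<forall>a\<in>mspace dJ. \<forall>\<alpha>. 0 < \<alpha> \<and> \<alpha> \<le> \<epsilon> \<longrightarrow>
          limit_shift E G act ` mball_of dJ a \<alpha> = mball_of dJ (limit_shift E G act a) (c * \<alpha>))
       \<longrightarrow>
       (\<exists>dS :: (int \<Rightarrow> 'e) set metric.
          mtopology_of dS = limit_solenoid E G act \<and>
          (\<forall>x\<in>bi_inf_paths E. \<forall>y\<in>bi_inf_paths E.
             mdist dS (bi_class E G act x) (bi_class E G act y) =
             (SUP m::nat. (1 / c) ^ m *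
                mdist dJ (left_class E G act (left_half x (int m)))
                         (left_class E G act (left_half y (int m))))) \<and>
          (\<exists>\<epsilon>S br. smale_space dS \<tau>' \<epsilon>S (1 / c) br \<and>
             totally_disconnected_stable_sets dS \<tau>' \<epsilon>S br))) \<and>
    (strongly_connected_graph E \<longrightarrow> irreducible_system (limit_solenoid E G act) \<tau>') \<and>
    (primitive_graph E \<longrightarrow> mixing_system (limit_solenoid E G act) \<tau>')"
proof -
  interpret fin_digraph E by (rule assms(1))
  interpret self_similar_action E G act by (rule assms(4))
  interpret contracting_action E G act
    by unfold_locales (use assms in auto)
  \<comment> \<open>The homeomorphism is fixed before \<open>\<epsilon>\<close>, \<open>c\<close>
    and \<open>dJ\<close> are given; \<open>natural_extension\<close> therefore takes it as a
    parameter.\<close>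
  let ?\<tau> = "translate (- 1)"
  have "\<exists>dS :: (int \<Rightarrow> 'e) set metric.
      mtopology_of dS = solenoid \<and>
      (\<forall>x\<in>bi_inf_paths E. \<forall>y\<in>bi_inf_paths E.
         mdist dS (bi_class E G act x) (bi_class E G act y) =
         (SUP m::nat. (1 / c) ^ m *
            mdist dJ (left_class E G act (left_half x (int m)))
                     (left_class E G act (left_half y (int m))))) \<and>
      (\<exists>\<epsilon>S br. smale_space dS ?\<tau> \<epsilon>S (1 / c) br \<and>
         totally_disconnected_stable_sets dS ?\<tau> \<epsilon>S br)"
    if h: "\<epsilon> > 0 \<and> c > 1 \<and> mtopology_of dJ = limit_space E G act \<and>
       (\<forall>a\<in>mspace dJ. \<forall>b\<in>mspace dJ. mdist dJ a b < \<epsilon> \<longrightarrow>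
          mdist dJ (limit_shift E G act a) (limit_shift E G act b) = c * mdist dJ a b) \<and>
       (\<forall>a\<in>mspace dJ. \<forall>\<alpha>. 0 < \<alpha> \<and> \<alpha> \<le> \<epsilon> \<longrightarrow>
          limit_shift E G act ` mball_of dJ a \<alpha> = mball_of dJ (limit_shift E G act a) (c * \<alpha>))"
    for \<epsilon> c :: real and dJ :: "(nat \<Rightarrow> 'e) set metric"
  proof -
    interpret natural_extension solenoid dJ "limit_shift E G act" coord ?\<tau> \<epsilon> c
      using h by (intro natural_extension_solenoid) blast+
    have "mdist dS (bi_class E G act x) (bi_class E G act y) =
         (SUP m::nat. (1 / c) ^ m *
            mdist dJ (left_class E G act (left_half x (int m)))
                     (left_class E G act (left_half y (int m))))"
      if "x \<in> bi_inf_paths E" "y \<in> bi_inf_paths E" for x y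
      using that by (simp add: bi_class_in ext_dist_def coord_bi_class)
    then show ?thesis
      using mtopology_dS smale_space_ext_dist totally_disconnected_stable_sets_ext_dist by blast
  qed
  then show ?thesis
    using homeomorphic_map_translate[of "- 1"] translate_bi_shift irreducible_solenoid mixing_solenoid
    by (intro exI[of _ ?\<tau>]) blast
qed

end
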